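(* Let $\beta\in[0,1)$, let $a,b,c\in\mathbb{R}$ satisfy either ($c=0$ and $a\neq b$) or ($c>0$ and $a<b$), and let $\nu\in\mathbb{R}$ with $Q(\nu)\neq 0$. Then the following hold. (a) If $\nu\geq\max\{0,\nu_0\}$ and $\nu\neq0$, then the radius of convexity of order $\beta$, $r^{c}_{\beta}(f_\nu)$, is the smallest positive root of the equation $$1+\frac{rN_\nu''(r)}{N_\nu'(r)}+\left(\frac1\nu-1\right)\frac{rN_\nu'(r)}{N_\nu(r)}=\beta.$$ Moreover, $r^{c}_{\beta}(f_\nu)<\lambda_{\nu,1}'<\lambda_{\nu,1}$, where $\lambda_{\nu,1}$ and $\lambda_{\nu,1}'$ are the smallest positive zeros of $N_\nu$ and $N_\nu'$, respectively. (b) If $\nu\geq\max\{0,\nu_0\}$, then the radius of convexity of order $\beta$, $r^{c}_{\beta}(g_\nu)$, is the smallest positive root of the equation $$1+\frac{r^2N_\nu''(r)+(2-2\nu)rN_\nu'(r)+(\nu^2-\nu)N_\nu(r)}{rN_\nu'(r)+(1-\nu)N_\nu(r)}=\beta.$$ (c) If $\nu\geq\max\{0,\nu_0\}$, then the radius of convexity of order $\beta$, $r^{c}_{\beta}(h_\nu)$, is the smallest positive root of the equation $$1+\frac{rN_\nu''(\sqrt r)+(3-2\nu)\sqrt r\,N_\nu'(\sqrt r)+(\nu^2-2\nu)N_\nu(\sqrt r)}{2\sqrt r\,N_\nu'(\sqrt r)+2(2-\nu)N_\nu(\sqrt r)}=\beta.$$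
   Context: $J_\nu(z)=\sum_{n\ge 0}\frac{(-1)^n}{n!\,\Gamma(n+\nu+1)}\left(\frac z2\right)^{2n+\nu}$ is the Bessel function of the first kind of order $\nu$. For real $a,b,c$ put $N_\nu(z)=az^2J_\nu''(z)+bzJ_\nu'(z)+cJ_\nu(z)$ and $Q(\nu)=a\nu(\nu-1)+b\nu+c$. $\nu_0$ denotes the largest real root of the quadratic $Q$ (if $Q$ has no real root, $\max\{0,\nu_0\}$ is read as $0$). Normalized functions (defined when $Q(\nu)\ne0$): $f_\nu(z)=\left[\frac{2^\nu\Gamma(\nu+1)}{Q(\nu)}N_\nu(z)\right]^{1/\nu}$ (for $\nu\neq0$; the branch analytic near $0$ with $f_\nu(0)=0$, $f_\nu'(0)=1$), $g_\nu(z)=\frac{2^\nu\Gamma(\nu+1)z^{1-\nu}}{Q(\nu)}N_\nu(z)$, and $h_\nu(z)=\frac{2^\nu\Gamma(\nu+1)z^{1-\nu/2}}{Q(\nu)}N_\nu(\sqrt z)$. Each is analytic near $0$ with value $0$ and derivative $1$ at $0$. $\mathbb{D}_r=\{z\in\mathbb{C}:|z|<r\}$. For $f$ analytic near $0$ with $f(0)=0,\ f'(0)=1$ and power series with radius of convergence $r_f\in(0,\infty]$, the radius of convexity of order $\beta$ is $r_\beta^{c}(f)=\sup\{r\in(0,r_f):\operatorname{Re}\left(1+\frac{zf''(z)}{f'(z)}\right)>\beta\text{ for all }z\in\mathbb{D}_r\}$. *)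

theory Defs
  imports "HOL-Complex_Analysis.Complex_Analysis"
begin

text \<open>
  Complex powers are principal branches, so \<open>bessel_J \<nu>\<close> and the functions below are the usual ones
  on the plane slit along the nonpositive real axis.  At \<open>z = 0\<close> the library convention
  \<open>0 powr s = 0\<close> applies (also for \<open>s = 0\<close>); values at 0 and on the slit are never used.
\<close>

definition bessel_J :: "real \<Rightarrow> complex \<Rightarrow> complex" where
  "bessel_J \<nu> z =
     (\<Sum>n. of_real ((-1) ^ n / (fact n * Gamma (real n + \<nu> + 1)))
            * (z / 2) powr of_real (2 * real n + \<nu>))"

definition bessel_N :: "real \<Rightarrow> real \<Rightarrow> real \<Rightarrow> real \<Rightarrow> complex \<Rightarrow> complex" where
  "bessel_N a b c \<nu> z =
     of_real a * z\<^sup>2 * deriv (deriv (bessel_J \<nu>)) z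
     + of_real b * z * deriv (bessel_J \<nu>) z
     + of_real c * bessel_J \<nu> z"

definition Q_poly :: "real \<Rightarrow> real \<Rightarrow> real \<Rightarrow> real \<Rightarrow> real" where
  "Q_poly a b c x = a * x * (x - 1) + b * x + c"

text \<open>The leading coefficient \<open>a\<close> may be zero; \<open>\<nu>\<^sub>0\<close> is then the root of a linear polynomial.\<close>

definition nu0 :: "real \<Rightarrow> real \<Rightarrow> real \<Rightarrow> real" where
  "nu0 a b c = Max {x. Q_poly a b c x = 0}"

definition max_0_nu0 :: "real \<Rightarrow> real \<Rightarrow> real \<Rightarrow> real" where
  "max_0_nu0 a b c = (if \<exists>x. Q_poly a b c x = 0 then max 0 (nu0 a b c) else 0)"

text \<open>
  A function analytic near 0 is represented by its power series at 0.  The formulas for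
  \<open>f\<^sub>\<nu>\<close>, \<open>g\<^sub>\<nu>\<close>, \<open>h\<^sub>\<nu>\<close> involve multivalued powers, so each function is taken to be the
  power series, normalised by value 0 and derivative 1 at 0, that agrees with its formula on
  some interval \<open>(0, \<epsilon>)\<close> of the real axis.  By the identity theorem there is at most one.  For small
  \<open>x > 0\<close> the expression inside the \<open>1/\<nu>\<close>-th power in \<open>f\<^sub>\<nu>\<close> is a positive real asymptotic to
  \<open>x powr \<nu>\<close>, so the principal power is the required branch there.
\<close>

definition normalized_germ :: "(complex \<Rightarrow> complex) \<Rightarrow> complex fps" where
  "normalized_germ \<phi> =
     (THE F. fps_conv_radius F > 0 \<and> fps_nth F 0 = 0 \<and> fps_nth F 1 = 1 \<and>
        (\<forall>\<^sub>F x in at_right (0::real). eval_fps F (of_real x) = \<phi> (of_real x)))"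

definition norm_const :: "real \<Rightarrow> real \<Rightarrow> real \<Rightarrow> real \<Rightarrow> complex" where
  "norm_const a b c \<nu> = of_real (2 powr \<nu> * Gamma (\<nu> + 1) / Q_poly a b c \<nu>)"

definition f_fun :: "real \<Rightarrow> real \<Rightarrow> real \<Rightarrow> real \<Rightarrow> complex fps" where
  "f_fun a b c \<nu> = normalized_germ
     (\<lambda>z. (norm_const a b c \<nu> * bessel_N a b c \<nu> z) powr of_real (1 / \<nu>))"

definition g_fun :: "real \<Rightarrow> real \<Rightarrow> real \<Rightarrow> real \<Rightarrow> complex fps" where
  "g_fun a b c \<nu> = normalized_germ
     (\<lambda>z. norm_const a b c \<nu> * z powr of_real (1 - \<nu>) * bessel_N a b c \<nu> z)"

definition h_fun :: "real \<Rightarrow> real \<Rightarrow> real \<Rightarrow> real \<Rightarrow> complex fps" where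
  "h_fun a b c \<nu> = normalized_germ
     (\<lambda>z. norm_const a b c \<nu> * z powr of_real (1 - \<nu> / 2) * bessel_N a b c \<nu> (csqrt z))"

text \<open>
  The supremum is taken in the extended reals.  The conjunct on \<open>deriv f z\<close> excludes the
  convention \<open>x / 0 = 0\<close>, under which the inequality would hold at critical points of \<open>f\<close>.
\<close>

definition convexity_radius :: "real \<Rightarrow> complex fps \<Rightarrow> ereal" where
  "convexity_radius \<beta> F =
     (let f = eval_fps F in
      Sup {ereal r | r. 0 < r \<and> ereal r < fps_conv_radius F \<and>
             (\<forall>z. norm z < r \<longrightarrow>
                deriv f z \<noteq> 0 \<and> Re (1 + z * deriv (deriv f) z / deriv f z) > \<beta>)})"

definition is_least_pos :: "(real \<Rightarrow> bool) \<Rightarrow> real \<Rightarrow> bool" where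
  "is_least_pos P r \<longleftrightarrow> 0 < r \<and> P r \<and> (\<forall>s. 0 < s \<and> P s \<longrightarrow> r \<le> s)"

text \<open>
  The left-hand sides of the three equations at real \<open>r > 0\<close>, stated for an arbitrary function \<open>N\<close>.
  A root must be a point at which no denominator vanishes, again because of \<open>x / 0 = 0\<close>.
\<close>

definition f_root :: "(complex \<Rightarrow> complex) \<Rightarrow> real \<Rightarrow> real \<Rightarrow> real \<Rightarrow> bool" where
  "f_root N \<nu> \<beta> r \<longleftrightarrow>
     (let z = complex_of_real r; v = complex_of_real \<nu> in
        deriv N z \<noteq> 0 \<and> N z \<noteq> 0 \<and>
        1 + z * deriv (deriv N) z / deriv N z + (1 / v - 1) * (z * deriv N z / N z) = of_real \<beta>)"

definition g_root :: "(complex \<Rightarrow> complex) \<Rightarrow> real \<Rightarrow> real \<Rightarrow> real \<Rightarrow> bool" where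
  "g_root N \<nu> \<beta> r \<longleftrightarrow>
     (let z = complex_of_real r; v = complex_of_real \<nu>;
          d = z * deriv N z + (1 - v) * N z in
        d \<noteq> 0 \<and>
        1 + (z\<^sup>2 * deriv (deriv N) z + (2 - 2 * v) * z * deriv N z + (v\<^sup>2 - v) * N z) / d
          = of_real \<beta>)"

definition h_root :: "(complex \<Rightarrow> complex) \<Rightarrow> real \<Rightarrow> real \<Rightarrow> real \<Rightarrow> bool" where
  "h_root N \<nu> \<beta> r \<longleftrightarrow>
     (let z = complex_of_real r; s = complex_of_real (sqrt r); v = complex_of_real \<nu>;
          d = 2 * s * deriv N s + 2 * (2 - v) * N s in
        d \<noteq> 0 \<and>
        1 + (z * deriv (deriv N) s + (3 - 2 * v) * s * deriv N s + (v\<^sup>2 - 2 * v) * N s) / d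
          = of_real \<beta>)"

end

theory Submission
  imports Defs
begin

text \<open>
  In the variable \<open>w = z\<^sup>2 / 4\<close>, or \<open>w = z / 4\<close> for \<open>h\<^sub>\<nu>\<close>, every function of the theorem is a power of \<open>z\<close>
  times a power series. Classically the result rests on the reality and interlacing of the zeros of
  \<open>N\<^sub>\<nu>\<close> and its relatives and on Hadamard factorisation. Here both are replaced by one property of
  a power series \<open>G\<close> with \<open>G (0) = 1\<close>: all coefficients of \<open>- G' / G\<close> are nonnegative. For the
  functions in question these coefficients are the Rayleigh sums over the zeros, and so positivity of
  all zeros implies the property. The proof works with the coefficients and never lists the zeros.

  For the Bessel series the property follows from a Riccati equation (\<open>bessel_riccati\<close>). It is
  preserved by the operators \<open>1 - t X + s X d/dX\<close> with \<open>s > 0\<close> and \<open>t \<ge> 0\<close>: if such an operator maps \<open>G\<close> to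
  \<open>D = (1 - S) G\<close>, then \<open>S\<close> has nonnegative coefficients and \<open>- D' / D = - G' / G + S' / (1 - S)\<close>
  (\<open>neg_log_deriv_theta_step\<close>). The hypotheses on \<open>a\<close>, \<open>b\<close>, \<open>c\<close> and \<open>\<nu>\<close> allow
  the normalised series \<open>M\<close> of \<open>N\<^sub>\<nu>\<close> to be obtained from the Bessel series by one or two such operators
  (\<open>normalized_series_exists\<close>). One more operator leads from \<open>M\<close> to the series \<open>D\<close> that governs
  \<open>N\<^sub>\<nu>'\<close>, \<open>g\<^sub>\<nu>'\<close> or \<open>h\<^sub>\<nu>'\<close>.

  For each of the three functions, \<open>1 + z f'' / f' = 1 - A\<close>, where \<open>A\<close> is a power series with nonnegative
  coefficients and \<open>A (0) = 0\<close>. Therefore \<open>\<bar>A (z)\<bar> \<le> A (\<bar>z\<bar>)\<close>, the real part is smallest at the positive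
  real point of a circle, and the convexity radius is the first \<open>r\<close> with \<open>1 - A (r) = \<beta>\<close>
  (\<open>convexity_radius_eq_first_root\<close>). For \<open>f\<^sub>\<nu>\<close> with \<open>\<nu> > 1\<close>, the series \<open>A\<close> is a difference, and the
  coefficientwise inequality between \<open>- D' / D\<close> and \<open>- M' / M\<close> takes the place of interlacing.

  That \<open>r\<close> exists, and that the zeros come in the stated order, follows from the
  radius of convergence of \<open>- G' / G\<close>. If it is finite, then \<open>G\<close> vanishes at that positive point, which
  is its first zero, and \<open>- G' / G\<close> is unbounded before it (\<open>eval_first_zero\<close>, \<open>neg_log_deriv_unbounded\<close>).
  Since then \<open>S\<close> takes the value 1 earlier, each operator moves the first zero strictly to the left
  (\<open>theta_step_rayleigh_positive\<close>).
\<close>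

section \<open>Power series with nonnegative coefficients\<close>

definition nonneg_coeffs :: "complex fps \<Rightarrow> bool" where
  "nonneg_coeffs A \<longleftrightarrow> (\<forall>k. fps_nth A k \<in> \<real>\<^sub>\<ge>\<^sub>0)"

lemma nonneg_coeffsD: "nonneg_coeffs A \<Longrightarrow> fps_nth A k \<in> \<real>\<^sub>\<ge>\<^sub>0"
  by (simp add: nonneg_coeffs_def)

lemma nonneg_Reals_sum:
  "(\<And>i. i \<in> I \<Longrightarrow> f i \<in> \<real>\<^sub>\<ge>\<^sub>0) \<Longrightarrow> sum f I \<in> (\<real>\<^sub>\<ge>\<^sub>0 :: complex set)"
  by (induction I rule: infinite_finite_induct) auto

lemma nonneg_coeffs_add: "nonneg_coeffs A \<Longrightarrow> nonneg_coeffs B \<Longrightarrow> nonneg_coeffs (A + B)"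
  by (simp add: nonneg_coeffs_def)

lemma nonneg_coeffs_mult: "nonneg_coeffs A \<Longrightarrow> nonneg_coeffs B \<Longrightarrow> nonneg_coeffs (A * B)"
  by (auto simp: nonneg_coeffs_def fps_mult_nth intro!: nonneg_Reals_sum)

lemma nonneg_coeffs_const: "0 \<le> x \<Longrightarrow> nonneg_coeffs (fps_const (complex_of_real x))"
  by (simp add: nonneg_coeffs_def)

lemma nonneg_coeffs_X: "nonneg_coeffs fps_X"
  by (simp add: nonneg_coeffs_def fps_X_def)

lemma nonneg_coeffs_deriv: "nonneg_coeffs A \<Longrightarrow> nonneg_coeffs (fps_deriv A)"
  unfolding nonneg_coeffs_def fps_deriv_nth by (metis nonneg_Reals_mult_I nonneg_Reals_of_nat_I)

text \<open>The inverse is the geometric series \<open>1 + S + S\<^sup>2 + \<dots>\<close>; the recursion \<open>V = 1 + S V\<close> computes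
  its coefficients one after the other.\<close>

lemma nonneg_coeffs_inverse_one_minus:
  assumes S: "nonneg_coeffs S" and S0: "fps_nth S 0 = 0"
  shows "nonneg_coeffs (inverse (1 - S))"
proof -
  define V where "V = inverse (1 - S)"
  have "(1 - S) * V = 1"
    unfolding V_def by (rule inverse_mult_eq_1') (simp add: S0)
  then have V: "V = 1 + S * V" by (simp add: algebra_simps)
  have "fps_nth V n \<in> \<real>\<^sub>\<ge>\<^sub>0" for n
  proof (induction n rule: less_induct)
    case (less n)
    have "fps_nth S i * fps_nth V (n - i) \<in> \<real>\<^sub>\<ge>\<^sub>0" if "i \<in> {0..n}" for i
      using less[of "n - i"] S S0 that
      by (cases "i = 0") (auto simp: nonneg_coeffs_def)
    then have "fps_nth (1 + S * V) n \<in> \<real>\<^sub>\<ge>\<^sub>0"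
      by (auto simp: fps_mult_nth intro!: nonneg_Reals_add_I nonneg_Reals_sum)
    then show ?case by (simp only: V[symmetric])
  qed
  then show ?thesis by (simp add: nonneg_coeffs_def V_def)
qed

text \<open>The triangle inequality for power series is sharp at positive real points. This is the only
  source of the extremal property of the positive real axis in all three convexity radii.\<close>

lemma
  assumes A: "nonneg_coeffs A" and z: "ereal (norm z) < fps_conv_radius A"
  shows eval_nonneg_coeffs_real: "eval_fps A (of_real (norm z)) = of_real (Re (eval_fps A (of_real (norm z))))"
    and eval_nonneg_coeffs_nonneg: "0 \<le> Re (eval_fps A (of_real (norm z)))"
    and norm_eval_nonneg_coeffs_le: "norm (eval_fps A z) \<le> Re (eval_fps A (of_real (norm z)))"
proof -
  define a where "a k = Re (fps_nth A k)" for k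
  have a: "fps_nth A k = of_real (a k)" "0 \<le> a k" for k
    using nonneg_coeffsD[OF A, of k] by (auto simp: a_def complex_nonneg_Reals_iff complex_eq_iff)
  have "(\<lambda>k. fps_nth A k * of_real (norm z) ^ k) sums eval_fps A (of_real (norm z))"
    by (rule sums_eval_fps) (use z in simp)
  then have s: "(\<lambda>k. of_real (a k * norm z ^ k) :: complex) sums eval_fps A (of_real (norm z))"
    by (simp add: a)
  then have sR: "(\<lambda>k. a k * norm z ^ k) sums Re (eval_fps A (of_real (norm z)))"
    by (metis (mono_tags, lifting) sums_Re Re_complex_of_real sums_cong)
  show "eval_fps A (of_real (norm z)) = of_real (Re (eval_fps A (of_real (norm z))))"
    using sums_unique2[OF s] sR sums_of_real by blast
  show "0 \<le> Re (eval_fps A (of_real (norm z)))"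
    by (rule sums_le[OF _ sums_zero sR]) (simp add: a(2))
  have t: "(\<lambda>k. fps_nth A k * z ^ k) sums eval_fps A z"
    by (rule sums_eval_fps) (use z in simp)
  have n: "norm (fps_nth A k * z ^ k) = a k * norm z ^ k" for k
    using a by (simp add: norm_mult norm_power)
  have "norm (suminf (\<lambda>k. fps_nth A k * z ^ k)) \<le> suminf (\<lambda>k. norm (fps_nth A k * z ^ k))"
    by (rule summable_norm) (use sR n in \<open>simp add: sums_iff\<close>)
  then show "norm (eval_fps A z) \<le> Re (eval_fps A (of_real (norm z)))"
    using t sR by (simp add: sums_iff n)
qed

definition real_eval :: "complex fps \<Rightarrow> real \<Rightarrow> real" where
  "real_eval A x = Re (eval_fps A (of_real x))"

lemma eval_fps_of_real:
  assumes "nonneg_coeffs A" "0 \<le> x" "ereal x < fps_conv_radius A"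
  shows "eval_fps A (of_real x) = of_real (real_eval A x)"
  using eval_nonneg_coeffs_real[of A "of_real x"] assms by (simp add: real_eval_def)

lemma real_eval_nonneg:
  assumes "nonneg_coeffs A" "0 \<le> x" "ereal x < fps_conv_radius A"
  shows "0 \<le> real_eval A x"
  using eval_nonneg_coeffs_nonneg[of A "of_real x"] assms by (simp add: real_eval_def)

lemma norm_eval_fps_le_real_eval:
  assumes "nonneg_coeffs A" "ereal (norm z) < fps_conv_radius A"
  shows "norm (eval_fps A z) \<le> real_eval A (norm z)"
  using norm_eval_nonneg_coeffs_le[OF assms] by (simp add: real_eval_def)

lemma has_derivative_real_eval:
  assumes "ereal \<bar>x\<bar> < fps_conv_radius A"
  shows "(real_eval A has_real_derivative real_eval (fps_deriv A) x) (at x within S)"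
proof -
  have "(eval_fps A has_field_derivative eval_fps (fps_deriv A) (of_real x)) (at (complex_of_real x))"
    by (rule has_field_derivative_eval_fps) (use assms in simp)
  then have "((\<lambda>x. eval_fps A (complex_of_real x)) has_vector_derivative
      eval_fps (fps_deriv A) (of_real x)) (at x within S)"
    by (rule has_vector_derivative_real_field)
  then have "((\<lambda>x. Re (eval_fps A (complex_of_real x))) has_vector_derivative
      Re (eval_fps (fps_deriv A) (of_real x))) (at x within S)"
    by (rule bounded_linear.has_vector_derivative[OF bounded_linear_Re])
  then show ?thesis
    unfolding real_eval_def[abs_def] by (simp add: has_real_derivative_iff_has_vector_derivative)
qed

lemma continuous_on_real_eval:
  assumes "\<And>x. x \<in> I \<Longrightarrow> ereal \<bar>x\<bar> < fps_conv_radius A"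
  shows "continuous_on I (real_eval A)"
  by (meson DERIV_continuous_on assms has_derivative_real_eval)

lemma real_eval_mono:
  assumes A: "nonneg_coeffs A" and "0 \<le> x" "x \<le> y" and y: "ereal y < fps_conv_radius A"
  shows "real_eval A x \<le> real_eval A y"
proof (rule DERIV_nonneg_imp_nondecreasing[OF \<open>x \<le> y\<close>])
  fix t assume t: "x \<le> t" "t \<le> y"
  have r: "ereal t < fps_conv_radius A"
    using t y by (metis ereal_less_eq(3) order_le_less_trans)
  have r': "ereal t < fps_conv_radius (fps_deriv A)"
    using r fps_conv_radius_deriv[of A] by (rule less_le_trans)
  show "\<exists>d. (real_eval A has_real_derivative d) (at t) \<and> 0 \<le> d"
    using has_derivative_real_eval[of t A UNIV] real_eval_nonneg[OF nonneg_coeffs_deriv[OF A] _ r']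
      r t \<open>0 \<le> x\<close> by auto
qed

section \<open>Logarithmic derivatives\<close>

text \<open>If \<open>G (0) = 1\<close> and \<open>G\<close> is the product of the factors \<open>1 - X / x\<close> over its zeros \<open>x\<close>, then the
  \<open>k\<close>-th coefficient of this series is the Rayleigh sum of the powers \<open>1 / x ^ (k + 1)\<close>.\<close>

definition neg_log_deriv :: "complex fps \<Rightarrow> complex fps" where
  "neg_log_deriv G = - fps_deriv G * inverse G"

lemma fps_deriv_eq_neg_log_deriv:
  assumes "fps_nth G 0 = 1"
  shows "fps_deriv G = - neg_log_deriv G * G"
  using assms inverse_mult_eq_1[of G] by (simp add: neg_log_deriv_def mult.assoc)

lemma neg_log_deriv_unique:
  assumes "fps_nth G 0 = 1" "fps_deriv G = - u * G"
  shows "neg_log_deriv G = u"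
  using assms inverse_mult_eq_1'[of G] by (simp add: neg_log_deriv_def mult.assoc)

text \<open>The operator \<open>1 - t X + s X d/dX\<close>. For \<open>s > 0\<close> and \<open>t \<ge> 0\<close> it keeps all zeros real and positive, by
  Rolle's theorem for \<open>X powr (1 / s) * exp (- t X / s) * G\<close>; the lemmas below express this classical
  fact by Rayleigh sums. Every series of the proof arises from the Bessel series by such steps.\<close>

definition theta_step :: "real \<Rightarrow> real \<Rightarrow> complex fps \<Rightarrow> complex fps" where
  "theta_step s t G = G - fps_const (of_real t) * fps_X * G + fps_const (of_real s) * fps_X * fps_deriv G"

text \<open>The quotient of \<open>theta_step s t G\<close> by \<open>G\<close> is \<open>1 - theta_factor s t G\<close>.\<close>

definition theta_factor :: "real \<Rightarrow> real \<Rightarrow> complex fps \<Rightarrow> complex fps" where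
  "theta_factor s t G = fps_const (of_real t) * fps_X + fps_const (of_real s) * fps_X * neg_log_deriv G"

lemma theta_step_eq_mult:
  assumes "fps_nth G 0 = 1"
  shows "theta_step s t G = (1 - theta_factor s t G) * G"
  using fps_deriv_eq_neg_log_deriv[OF assms] by (simp add: theta_step_def theta_factor_def algebra_simps)

lemma theta_step_nth_0 [simp]: "fps_nth (theta_step s t G) 0 = fps_nth G 0"
  by (simp add: theta_step_def mult.assoc)

lemma nonneg_coeffs_theta_factor:
  assumes "nonneg_coeffs (neg_log_deriv G)" "0 \<le> s" "0 \<le> t"
  shows "nonneg_coeffs (theta_factor s t G)"
  unfolding theta_factor_def
  by (intro nonneg_coeffs_add nonneg_coeffs_mult nonneg_coeffs_const nonneg_coeffs_X assms)

text \<open>With \<open>S = theta_factor s t G\<close>, taking the logarithmic derivative of the product \<open>(1 - S) G\<close>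
  increases \<open>- G' / G\<close> by \<open>S' / (1 - S)\<close>, where \<open>S\<close> has nonnegative coefficients. For a sequence of
  zeros, the coefficientwise inequality would follow from the interlacing of the new zeros with the
  old ones.\<close>

lemma neg_log_deriv_theta_step:
  assumes G0: "fps_nth G 0 = 1" and u: "nonneg_coeffs (neg_log_deriv G)" and "0 \<le> s" "0 \<le> t"
  shows "nonneg_coeffs (neg_log_deriv (theta_step s t G) - neg_log_deriv G)"
proof -
  define S where "S = theta_factor s t G"
  have S: "nonneg_coeffs S" unfolding S_def by (rule nonneg_coeffs_theta_factor) fact+
  have S0: "fps_nth S 0 = 0" by (simp add: S_def theta_factor_def mult.assoc)
  define v where "v = fps_deriv S * inverse (1 - S)"
  have v: "v * (1 - S) = fps_deriv S"
    unfolding v_def using inverse_mult_eq_1[of "1 - S"] S0 by (simp add: mult.assoc)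
  have "fps_deriv (theta_step s t G) = - (neg_log_deriv G + v) * theta_step s t G"
  proof -
    have "fps_deriv ((1 - S) * G) = (1 - S) * fps_deriv G - fps_deriv S * G"
      by (simp add: algebra_simps)
    also have "\<dots> = (1 - S) * (- neg_log_deriv G * G) - v * (1 - S) * G"
      using fps_deriv_eq_neg_log_deriv[OF G0] by (simp only: v)
    finally show ?thesis
      by (simp add: theta_step_eq_mult[OF G0] S_def algebra_simps)
  qed
  then have "neg_log_deriv (theta_step s t G) = neg_log_deriv G + v"
    by (intro neg_log_deriv_unique) (simp_all add: G0)
  moreover have "nonneg_coeffs v"
    unfolding v_def
    by (intro nonneg_coeffs_mult nonneg_coeffs_deriv nonneg_coeffs_inverse_one_minus S S0)
  ultimately show ?thesis by simp
qed

section \<open>Entire functions with nonnegative Rayleigh sums\<close>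

lemma fps_conv_radius_integral0:
  fixes A :: "complex fps"
  shows "fps_conv_radius A \<le> fps_conv_radius (fps_integral0 A)"
  unfolding fps_conv_radius_def[of "fps_integral0 A"]
proof (rule conv_radius_geI_ex')
  fix r :: real assume r: "0 < r" "ereal r < fps_conv_radius A"
  have "summable (\<lambda>n. norm (fps_nth A n * of_real r ^ n))"
    by (rule norm_summable_fps) (use r in simp)
  then have s: "summable (\<lambda>n. r * norm (fps_nth A n * of_real r ^ n))"
    by (rule summable_mult)
  have "summable (\<lambda>n. fps_nth (fps_integral0 A) (Suc n) * of_real r ^ Suc n)"
  proof (rule summable_comparison_test'[OF s])
    fix n :: nat
    have "norm (fps_nth (fps_integral0 A) (Suc n) * of_real r ^ Suc n)
        = r * norm (fps_nth A n * of_real r ^ n) / norm (of_nat (Suc n) :: complex)"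
      using r by (simp add: fps_integral_def norm_mult norm_divide norm_power norm_inverse field_simps
          del: of_nat_Suc)
    also have "\<dots> \<le> r * norm (fps_nth A n * of_real r ^ n) / 1"
      using r by (intro divide_left_mono) (auto simp del: of_nat_Suc)
    finally show "norm (fps_nth (fps_integral0 A) (Suc n) * of_real r ^ Suc n)
        \<le> r * norm (fps_nth A n * of_real r ^ n)" by simp
  qed
  then show "summable (\<lambda>n. fps_nth (fps_integral0 A) n * of_real r ^ n)"
    by (subst (asm) summable_Suc_iff)
qed

lemma nonneg_coeffs_integral0: "nonneg_coeffs A \<Longrightarrow> nonneg_coeffs (fps_integral0 A)"
  unfolding nonneg_coeffs_def
proof
  fix k assume A: "\<forall>k. fps_nth A k \<in> \<real>\<^sub>\<ge>\<^sub>0"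
  have "inverse (of_nat k) \<in> (\<real>\<^sub>\<ge>\<^sub>0 :: complex set)"
    by (intro nonneg_Reals_inverse_I) simp
  then show "fps_nth (fps_integral0 A) k \<in> \<real>\<^sub>\<ge>\<^sub>0"
    using A by (simp add: fps_integral_def)
qed

lemma eval_fps_deriv_neg_log_deriv:
  assumes "fps_nth G 0 = 1" "fps_conv_radius G = \<infinity>"
    and z: "ereal (norm z) < fps_conv_radius (neg_log_deriv G)"
  shows "eval_fps (fps_deriv G) z = - eval_fps (neg_log_deriv G) z * eval_fps G z"
proof -
  have "eval_fps (fps_deriv G) z = eval_fps ((- neg_log_deriv G) * G) z"
    using fps_deriv_eq_neg_log_deriv[of G] assms by simp
  also have "\<dots> = - eval_fps (neg_log_deriv G) z * eval_fps G z"
    by (subst eval_fps_mult) (use assms in \<open>simp_all add: eval_fps_minus\<close>)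
  finally show ?thesis .
qed

text \<open>Both sides solve the differential equation \<open>y' = G' / G * y\<close> with \<open>y (0) = 1\<close>. In particular
  an entire \<open>G\<close> has no zero in the disc of convergence of \<open>- G' / G\<close>.\<close>

lemma eval_fps_eq_exp_neg_log_deriv:
  assumes G0: "fps_nth G 0 = 1" and ent: "fps_conv_radius G = \<infinity>"
    and z: "ereal (norm z) < fps_conv_radius (neg_log_deriv G)"
  shows "eval_fps G z = exp (- eval_fps (fps_integral0 (neg_log_deriv G)) z)"
proof -
  define u where "u = neg_log_deriv G"
  define U where "U = fps_integral0 u"
  have U': "fps_deriv U = u" unfolding U_def by (rule fps_deriv_fps_integral)
  obtain r where r: "norm z < r" "ereal r < fps_conv_radius u"
    using z ereal_dense2 unfolding u_def by force
  define h where "h w = eval_fps G w * exp (eval_fps U w)" for w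
  have "\<exists>c. \<forall>w\<in>ball 0 r. h w = c"
  proof (rule has_field_derivative_zero_constant)
    fix w :: complex assume "w \<in> ball 0 r"
    then have w: "ereal (norm w) < fps_conv_radius u"
      using r by (meson ereal_less(2) ereal_less_eq(3) le_less_trans mem_ball_0 less_imp_le)
    have wU: "ereal (norm w) < fps_conv_radius U"
      using w fps_conv_radius_integral0[of u] unfolding U_def by (rule less_le_trans)
    have dG: "eval_fps (fps_deriv G) w = - eval_fps u w * eval_fps G w"
      using eval_fps_deriv_neg_log_deriv[OF G0 ent] w by (simp add: u_def)
    have "(eval_fps G has_field_derivative eval_fps (fps_deriv G) w) (at w within ball 0 r)"
      by (rule has_field_derivative_eval_fps) (simp add: ent)
    moreover have "(eval_fps U has_field_derivative eval_fps u w) (at w within ball 0 r)"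
      using has_field_derivative_eval_fps[OF wU] by (simp add: U')
    ultimately show "(h has_field_derivative 0) (at w within ball 0 r)"
      unfolding h_def by (auto intro!: derivative_eq_intros simp: dG U' ent wU)
  qed simp
  then obtain c where c: "\<And>w. w \<in> ball 0 r \<Longrightarrow> h w = c" by blast
  have r0: "0 < r" using r(1) norm_ge_zero le_less_trans by blast
  have "h z = h 0" using c[of z] c[of 0] r r0 by simp
  also have "h 0 = 1" by (simp add: h_def eval_fps_at_0 G0 U_def)
  finally show ?thesis
    by (simp add: h_def U_def u_def exp_minus field_simps)
qed

text \<open>The class of functions that the proof works with: entire with nonnegative Rayleigh sums and at
  least one zero. For an entire function without zeros the radius of convergence in the last conjunct
  would be infinite.\<close>

definition rayleigh_positive :: "complex fps \<Rightarrow> bool" where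
  "rayleigh_positive G \<longleftrightarrow> fps_conv_radius G = \<infinity> \<and> fps_nth G 0 = 1 \<and>
     nonneg_coeffs (neg_log_deriv G) \<and> fps_conv_radius (neg_log_deriv G) < \<infinity>"

text \<open>The radius of convergence of \<open>- G' / G\<close> is the smallest modulus of a zero, and by Pringsheim's
  argument there is a zero at the positive real point of that circle: see \<open>eval_first_zero\<close>.\<close>

definition first_zero :: "complex fps \<Rightarrow> real" where
  "first_zero G = real_of_ereal (fps_conv_radius (neg_log_deriv G))"

lemma neg_log_deriv_radius_pos:
  assumes "fps_nth G 0 = 1" "fps_conv_radius G = \<infinity>"
  shows "0 < fps_conv_radius (neg_log_deriv G)"
proof -
  have "0 < fps_conv_radius (inverse G)"
    by (rule fps_conv_radius_inverse_pos) (use assms in auto)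
  also have "\<dots> = min (fps_conv_radius (- fps_deriv G)) (fps_conv_radius (inverse G))"
    using fps_conv_radius_deriv[of G] assms by simp
  also have "\<dots> \<le> fps_conv_radius (neg_log_deriv G)"
    unfolding neg_log_deriv_def by (rule fps_conv_radius_mult)
  finally show ?thesis .
qed

lemma neg_log_deriv_radius_ge:
  assumes "fps_nth G 0 = 1" "fps_conv_radius G = \<infinity>"
    and "\<And>z. ereal (norm z) < r \<Longrightarrow> eval_fps G z \<noteq> 0"
  shows "r \<le> fps_conv_radius (neg_log_deriv G)"
proof -
  have "r \<le> min (fps_conv_radius (- fps_deriv G)) (fps_conv_radius (inverse G))"
    using fps_conv_radius_inverse[of r G] fps_conv_radius_deriv[of G] assms by simp
  also have "\<dots> \<le> fps_conv_radius (neg_log_deriv G)"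
    unfolding neg_log_deriv_def by (rule fps_conv_radius_mult)
  finally show ?thesis .
qed

lemma nonzero_in_neg_log_deriv_radius:
  assumes "fps_nth G 0 = 1" "fps_conv_radius G = \<infinity>" "ereal (norm z) < fps_conv_radius (neg_log_deriv G)"
  shows "eval_fps G z \<noteq> 0"
  using eval_fps_eq_exp_neg_log_deriv[OF assms] by simp

context
  fixes G :: "complex fps"
  assumes G: "rayleigh_positive G"
begin

lemma
  shows rayleigh_positive_entire: "fps_conv_radius G = \<infinity>"
    and rayleigh_positive_nth_0: "fps_nth G 0 = 1"
    and rayleigh_positive_nonneg: "nonneg_coeffs (neg_log_deriv G)"
    and first_zero_pos: "0 < first_zero G"
    and radius_eq_first_zero: "fps_conv_radius (neg_log_deriv G) = ereal (first_zero G)"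
proof -
  show *: "fps_conv_radius G = \<infinity>" "fps_nth G 0 = 1" "nonneg_coeffs (neg_log_deriv G)"
    using G by (auto simp: rayleigh_positive_def)
  have "0 < fps_conv_radius (neg_log_deriv G)" "fps_conv_radius (neg_log_deriv G) < \<infinity>"
    using G neg_log_deriv_radius_pos[of G] by (auto simp: rayleigh_positive_def)
  then show "0 < first_zero G" "fps_conv_radius (neg_log_deriv G) = ereal (first_zero G)"
    unfolding first_zero_def by (cases "fps_conv_radius (neg_log_deriv G)"; simp)+
qed

lemma nonzero_below_first_zero: "norm z < first_zero G \<Longrightarrow> eval_fps G z \<noteq> 0"
  using nonzero_in_neg_log_deriv_radius[OF rayleigh_positive_nth_0 rayleigh_positive_entire]
  by (simp add: radius_eq_first_zero)

lemma primitive_radius: "norm z < first_zero G \<Longrightarrow> ereal (norm z) < fps_conv_radius (fps_integral0 (neg_log_deriv G))"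
  by (intro less_le_trans[OF _ fps_conv_radius_integral0]) (simp add: radius_eq_first_zero)

lemma eval_eq_exp: "norm z < first_zero G \<Longrightarrow> eval_fps G z = exp (- eval_fps (fps_integral0 (neg_log_deriv G)) z)"
  using eval_fps_eq_exp_neg_log_deriv[OF rayleigh_positive_nth_0 rayleigh_positive_entire]
  by (simp add: radius_eq_first_zero)

lemma real_eval_eq_exp:
  assumes "0 \<le> x" "x < first_zero G"
  shows "real_eval G x = exp (- real_eval (fps_integral0 (neg_log_deriv G)) x)"
    and "eval_fps G (of_real x) = of_real (real_eval G x)"
proof -
  have r: "ereal x < fps_conv_radius (fps_integral0 (neg_log_deriv G))"
    using primitive_radius[of "complex_of_real x"] assms by simp
  have "eval_fps G (of_real x) = exp (- eval_fps (fps_integral0 (neg_log_deriv G)) (of_real x))"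
    by (rule eval_eq_exp) (use assms in simp)
  also have "eval_fps (fps_integral0 (neg_log_deriv G)) (of_real x) = of_real (real_eval (fps_integral0 (neg_log_deriv G)) x)"
    by (rule eval_fps_of_real)
      (use assms r nonneg_coeffs_integral0[OF rayleigh_positive_nonneg] in auto)
  finally have *: "eval_fps G (of_real x) = of_real (exp (- real_eval (fps_integral0 (neg_log_deriv G)) x))"
    by (simp flip: exp_of_real)
  then show "real_eval G x = exp (- real_eval (fps_integral0 (neg_log_deriv G)) x)"
    by (simp add: real_eval_def)
  with * show "eval_fps G (of_real x) = of_real (real_eval G x)" by simp
qed

text \<open>On a circle the modulus is smallest at the positive real point, because the primitive in the
  exponent has nonnegative coefficients.\<close>

lemma real_eval_le_norm:
  assumes "norm z < first_zero G"
  shows "real_eval G (norm z) \<le> norm (eval_fps G z)"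
proof -
  have "Re (eval_fps (fps_integral0 (neg_log_deriv G)) z) \<le> norm (eval_fps (fps_integral0 (neg_log_deriv G)) z)" by (rule complex_Re_le_cmod)
  also have "\<dots> \<le> real_eval (fps_integral0 (neg_log_deriv G)) (norm z)"
    by (rule norm_eval_fps_le_real_eval)
      (use nonneg_coeffs_integral0[OF rayleigh_positive_nonneg] primitive_radius[OF assms] in auto)
  finally show ?thesis
    using real_eval_eq_exp(1)[of "norm z"] assms by (simp add: eval_eq_exp norm_exp_eq_Re)
qed

lemma continuous_on_eval_G: "continuous_on S (eval_fps G)"
  using continuous_on_eval_fps[of G] rayleigh_positive_entire continuous_on_subset by auto

text \<open>Otherwise \<open>\<bar>G (z)\<bar> \<ge> G (\<bar>z\<bar>)\<close> excludes zeros from the closed disc, so by compactness from a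
  larger disc, in which \<open>- G' / G\<close> would then converge.\<close>

lemma eval_first_zero: "eval_fps G (of_real (first_zero G)) = 0"
proof (rule ccontr)
  assume nz: "eval_fps G (of_real (first_zero G)) \<noteq> 0"
  define R where "R = first_zero G"
  have R: "0 < R" using first_zero_pos by (simp add: R_def)
  have nzc: "eval_fps G z \<noteq> 0" if "norm z = R" for z
  proof -
    have lim: "((\<lambda>t. eval_fps G (of_real t * w)) \<longlongrightarrow> eval_fps G w) (at_left 1)" for w
    proof -
      have "continuous_on UNIV (\<lambda>t::real. eval_fps G (of_real t * w))"
        by (intro continuous_on_compose2[OF continuous_on_eval_G[of UNIV]] continuous_intros) auto
      then have "isCont (\<lambda>t::real. eval_fps G (of_real t * w)) 1"
        by (simp add: continuous_on_eq_continuous_at)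
      then show ?thesis
        using filterlim_at_split[of "\<lambda>t. eval_fps G (of_real t * w)" "nhds (eval_fps G w)" 1]
        by (simp add: isCont_def)
    qed
    have "norm (eval_fps G (of_real R)) \<le> norm (eval_fps G z)"
    proof (rule tendsto_le[OF _ tendsto_norm[OF lim] tendsto_norm[OF lim]])
      have "eventually (\<lambda>t::real. t \<in> {0<..<1}) (at_left 1)"
        by (rule eventually_at_left_real) simp
      then show "\<forall>\<^sub>F t in at_left 1. norm (eval_fps G (of_real t * of_real R)) \<le> norm (eval_fps G (of_real t * z))"
      proof eventually_elim
        case (elim t)
        have tR: "t * R < R" "0 \<le> t * R" using elim R by auto
        have n: "norm (of_real t * z) = t * R" using elim that by (simp add: norm_mult)
        have "eval_fps G (of_real (t * R)) = of_real (real_eval G (t * R))" "0 \<le> real_eval G (t * R)"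
          using real_eval_eq_exp[of "t * R"] tR by (auto simp: R_def)
        then have "norm (eval_fps G (of_real t * of_real R)) = real_eval G (t * R)" by simp
        also have "\<dots> \<le> norm (eval_fps G (of_real t * z))"
          using real_eval_le_norm[of "of_real t * z"] n tR by (simp add: R_def)
        finally show ?case .
      qed
    qed simp
    then show ?thesis using nz by (auto simp: R_def)
  qed
  have "cball 0 R \<subseteq> - (eval_fps G -` {0})"
    using nonzero_below_first_zero nzc unfolding R_def by force
  moreover have op: "open (- (eval_fps G -` {0}))"
    by (intro open_Compl closed_vimage continuous_on_eval_G) auto
  ultimately obtain e where e: "0 < e" "(\<Union>x\<in>cball 0 R. ball x e) \<subseteq> - (eval_fps G -` {0})"
    using compact_subset_open_imp_ball_epsilon_subset[OF compact_cball op] by blast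
  have "ereal (R + e) \<le> fps_conv_radius (neg_log_deriv G)"
  proof (rule neg_log_deriv_radius_ge[OF rayleigh_positive_nth_0 rayleigh_positive_entire])
    fix z :: complex assume "ereal (norm z) < ereal (R + e)"
    then have z: "norm z < R + e" by simp
    \<comment> \<open>\<open>z\<close> is within \<open>e\<close> of its radial projection to the disc\<close>
    define c where "c = R / (R + e)"
    have c: "0 < c" "c < 1" "(1 - c) * (R + e) = e" using R e by (simp_all add: c_def field_simps)
    have "norm (of_real c * z) \<le> c * (R + e)"
      using c z by (simp add: norm_mult mult_left_mono)
    then have "of_real c * z \<in> cball 0 R" using R e by (simp add: c_def)
    moreover have "dist (of_real c * z) z = (1 - c) * norm z"
    proof -
      have "of_real c * z - z = of_real (c - 1) * z" by (simp add: algebra_simps)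
      moreover have "\<bar>c - 1\<bar> = 1 - c" using c by simp
      ultimately show ?thesis by (simp only: dist_norm norm_mult norm_of_real)
    qed
    then have "dist (of_real c * z) z < e" using c z mult_strict_left_mono[of "norm z" "R + e" "1 - c"] by simp
    ultimately have "z \<in> (\<Union>x\<in>cball 0 R. ball x e)" by force
    then have "z \<in> - (eval_fps G -` {0})" by (rule subsetD[OF e(2)])
    then show "eval_fps G z \<noteq> 0" by simp
  qed
  then show False using e by (simp add: radius_eq_first_zero R_def)
qed

text \<open>If \<open>- G' / G \<le> K\<close> on the interval, then \<open>G (x) exp (K x)\<close> increases there and cannot tend from
  its initial value 1 to 0.\<close>

lemma neg_log_deriv_unbounded: "\<exists>x\<in>{0..<first_zero G}. K < real_eval (neg_log_deriv G) x"
proof (rule ccontr)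
  assume c: "\<not> ?thesis"
  define R where "R = first_zero G"
  define g where "g x = real_eval G x * exp (K * x)" for x
  have R: "0 \<le> R" using first_zero_pos by (simp add: R_def)
  have "g 0 \<le> g R"
  proof (rule DERIV_nonneg_imp_increasing_open[OF R])
    show "continuous_on {0..R} g"
      unfolding g_def by (intro continuous_intros continuous_on_real_eval) (simp add: rayleigh_positive_entire)
    fix x assume x: "0 < x" "x < R"
    have "(real_eval G has_real_derivative real_eval (fps_deriv G) x) (at x)"
      by (rule has_derivative_real_eval) (simp add: rayleigh_positive_entire)
    moreover have "real_eval (fps_deriv G) x = - real_eval (neg_log_deriv G) x * real_eval G x"
    proof -
      have r: "ereal x < fps_conv_radius (neg_log_deriv G)" using x by (simp add: radius_eq_first_zero R_def)
      have "eval_fps (fps_deriv G) (of_real x) = - eval_fps (neg_log_deriv G) (of_real x) * eval_fps G (of_real x)"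
        by (rule eval_fps_deriv_neg_log_deriv[OF rayleigh_positive_nth_0 rayleigh_positive_entire])
          (use r x in simp)
      also have "\<dots> = of_real (- real_eval (neg_log_deriv G) x * real_eval G x)"
        using eval_fps_of_real[OF rayleigh_positive_nonneg _ r] real_eval_eq_exp(2)[of x] x
        by (simp add: R_def)
      finally show ?thesis by (simp only: real_eval_def Re_complex_of_real)
    qed
    ultimately have "(g has_real_derivative (K - real_eval (neg_log_deriv G) x) * g x) (at x)"
      unfolding g_def by (auto intro!: derivative_eq_intros simp: algebra_simps)
    moreover have "real_eval (neg_log_deriv G) x \<le> K" using c x by (auto simp: R_def not_less)
    moreover have "0 \<le> g x" using real_eval_eq_exp(1)[of x] x by (simp add: g_def R_def)
    ultimately show "\<exists>y. (g has_real_derivative y) (at x) \<and> 0 \<le> y" by auto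
  qed
  moreover have "g R = 0" using eval_first_zero by (simp add: g_def real_eval_def R_def)
  moreover have "g 0 = 1" by (simp add: g_def real_eval_def eval_fps_at_0 rayleigh_positive_nth_0)
  ultimately show False by simp
qed

text \<open>Multiplication by \<open>x\<close> does no harm, since \<open>- G' / G\<close> increases and is therefore large only for
  \<open>x\<close> away from 0.\<close>

lemma times_neg_log_deriv_unbounded: "\<exists>x\<in>{0..<first_zero G}. K < x * real_eval (neg_log_deriv G) x"
proof -
  define R where "R = first_zero G"
  define u where "u = neg_log_deriv G"
  have R: "0 < R" using first_zero_pos by (simp add: R_def)
  have u: "nonneg_coeffs u" "fps_conv_radius u = ereal R"
    using rayleigh_positive_nonneg radius_eq_first_zero by (simp_all add: u_def R_def)
  obtain y where y: "0 \<le> y" "y < R" "max (2 * K / R) (real_eval u (R / 2)) < real_eval u y"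
    using neg_log_deriv_unbounded unfolding R_def u_def by fastforce
  have "R / 2 \<le> y"
    using real_eval_mono[OF u(1), of y "R / 2"] y R u by (cases "R / 2 \<le> y") auto
  have "K < (R / 2) * real_eval u y" using y R by (simp add: field_simps)
  also have "\<dots> \<le> y * real_eval u y"
    using y R u \<open>R / 2 \<le> y\<close> by (intro mult_right_mono real_eval_nonneg) auto
  finally show ?thesis using y unfolding R_def u_def by auto
qed

end

lemma entire_add: "fps_conv_radius A = \<infinity> \<Longrightarrow> fps_conv_radius B = \<infinity> \<Longrightarrow> fps_conv_radius (A + B) = \<infinity>"
  for A B :: "complex fps"
  using fps_conv_radius_add[of A B] by simp

lemma entire_mult: "fps_conv_radius A = \<infinity> \<Longrightarrow> fps_conv_radius B = \<infinity> \<Longrightarrow> fps_conv_radius (A * B) = \<infinity>"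
  for A B :: "complex fps"
  using fps_conv_radius_mult[of A B] by simp

lemma entire_diff: "fps_conv_radius A = \<infinity> \<Longrightarrow> fps_conv_radius B = \<infinity> \<Longrightarrow> fps_conv_radius (A - B) = \<infinity>"
  for A B :: "complex fps"
  using fps_conv_radius_diff[of A B] by simp

lemma entire_deriv: "fps_conv_radius A = \<infinity> \<Longrightarrow> fps_conv_radius (fps_deriv A) = \<infinity>"
  for A :: "complex fps"
  using fps_conv_radius_deriv[of A] by simp

lemmas entire_intros = entire_add entire_mult entire_diff entire_deriv
  fps_conv_radius_const fps_conv_radius_fps_X fps_conv_radius_numeral

lemma fps_conv_radius_theta_step:
  "fps_conv_radius G = \<infinity> \<Longrightarrow> fps_conv_radius (theta_step s t G) = \<infinity>"
  unfolding theta_step_def by (intro entire_intros)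

lemma eval_fps_theta_step:
  "fps_conv_radius G = \<infinity> \<Longrightarrow> eval_fps (theta_step s t G) z
    = eval_fps G z - of_real t * z * eval_fps G z + of_real s * z * eval_fps (fps_deriv G) z"
  unfolding theta_step_def by (simp add: eval_fps_add eval_fps_diff eval_fps_mult entire_intros)

text \<open>The factor \<open>S\<close> in \<open>D = (1 - S) G\<close> grows from 0 to infinity on the interval up to the first zero
  of \<open>G\<close> and takes the value 1 on the way. So \<open>D\<close> has a zero before that of \<open>G\<close>.\<close>

lemma theta_step_rayleigh_positive:
  assumes G: "rayleigh_positive G" and s: "0 < s" and t: "0 \<le> t"
  shows "rayleigh_positive (theta_step s t G)" and "first_zero (theta_step s t G) < first_zero G"
proof -
  define D where "D = theta_step s t G"
  define u where "u = neg_log_deriv G"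
  define R where "R = first_zero G"
  note G' = rayleigh_positive_entire[OF G] rayleigh_positive_nth_0[OF G] rayleigh_positive_nonneg[OF G]
  have u: "nonneg_coeffs u" "fps_conv_radius u = ereal R"
    using G'(3) radius_eq_first_zero[OF G] by (simp_all add: u_def R_def)
  have R: "0 < R" using first_zero_pos[OF G] by (simp add: R_def)
  have D: "fps_conv_radius D = \<infinity>" "fps_nth D 0 = 1"
    using fps_conv_radius_theta_step[OF G'(1)] G'(2) by (simp_all add: D_def)
  have nn: "nonneg_coeffs (neg_log_deriv D)"
    using nonneg_coeffs_add[OF neg_log_deriv_theta_step[OF G'(2,3)] G'(3), of s t] s t
    by (simp add: D_def)
  define S where "S x = t * x + s * x * real_eval u x" for x
  have S: "eval_fps D (of_real x) = of_real (1 - S x) * eval_fps G (of_real x)" if x: "0 \<le> x" "x < R" for x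
  proof -
    have r: "ereal x < fps_conv_radius u" using x by (simp add: u)
    have "eval_fps (fps_deriv G) (of_real x) = - eval_fps u (of_real x) * eval_fps G (of_real x)"
      unfolding u_def by (rule eval_fps_deriv_neg_log_deriv[OF G'(2,1)]) (use r x in \<open>simp add: u_def\<close>)
    also have "eval_fps u (of_real x) = of_real (real_eval u x)"
      by (rule eval_fps_of_real[OF u(1) x(1) r])
    finally show ?thesis
      by (simp add: D_def eval_fps_theta_step[OF G'(1)] S_def algebra_simps)
  qed
  obtain y where y: "0 \<le> y" "y < R" "1 / s < y * real_eval u y"
    using times_neg_log_deriv_unbounded[OF G] unfolding R_def u_def by fastforce
  have "1 \<le> s * (y * real_eval u y)" using y s by (simp add: field_simps)
  also have "\<dots> \<le> S y" using t y by (simp add: S_def)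
  finally have "1 \<le> S y" .
  moreover have "S 0 = 0" by (simp add: S_def)
  moreover have "continuous_on {0..y} S"
    unfolding S_def by (intro continuous_intros continuous_on_real_eval) (use y u in auto)
  ultimately obtain x where x: "0 \<le> x" "x \<le> y" "S x = 1"
    using IVT'[of S 0 1 y] y by auto
  then have z: "eval_fps D (of_real x) = 0" using S[of x] y by simp
  have "fps_conv_radius (neg_log_deriv D) \<le> ereal x"
    using nonzero_in_neg_log_deriv_radius[OF D(2,1), of "of_real x"] z x by force
  also have "\<dots> < ereal R" using x y by simp
  finally have l: "fps_conv_radius (neg_log_deriv D) < ereal R" .
  then show *: "rayleigh_positive (theta_step s t G)"
    using D nn unfolding rayleigh_positive_def D_def by (metis ereal_infty_less(1) less_trans ereal_less_PInfty)
  show "first_zero (theta_step s t G) < first_zero G"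
    using l radius_eq_first_zero[OF *] by (simp add: R_def D_def)
qed

section \<open>The Bessel series\<close>

text \<open>The function \<open>\<Gamma> (\<nu> + 1) (z / 2) powr (- \<nu>) J\<^sub>\<nu> (z)\<close> in the variable \<open>z\<^sup>2 / 4\<close>.\<close>

definition bessel_fps :: "real \<Rightarrow> complex fps" where
  "bessel_fps \<nu> = Abs_fps (\<lambda>k. of_real ((-1) ^ k / (fact k * pochhammer (\<nu> + 1) k)))"

lemma bessel_fps_nth_0: "fps_nth (bessel_fps \<nu>) 0 = 1"
  by (simp add: bessel_fps_def)

lemma bessel_fps_radius:
  assumes "0 \<le> \<nu>"
  shows "fps_conv_radius (bessel_fps \<nu>) = \<infinity>"
  unfolding fps_conv_radius_def
proof (rule conv_radius_inftyI'')
  fix z :: complex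
  have s: "summable (\<lambda>k. norm z ^ k /\<^sub>R fact k)" by (rule summable_exp_generic)
  show "summable (\<lambda>k. fps_nth (bessel_fps \<nu>) k * z ^ k)"
  proof (rule summable_comparison_test'[OF s])
    fix k :: nat
    have p: "1 \<le> pochhammer (\<nu> + 1) k"
    proof (induction k)
      case (Suc k)
      have "1 * 1 \<le> pochhammer (\<nu> + 1) k * (\<nu> + 1 + of_nat k)"
        using Suc assms by (intro mult_mono) auto
      then show ?case by (simp add: pochhammer_Suc)
    qed simp
    have "norm (fps_nth (bessel_fps \<nu>) k * z ^ k) = (norm z ^ k / fact k) / pochhammer (\<nu> + 1) k"
      using p by (simp add: bessel_fps_def norm_mult norm_divide norm_power)
    also have "\<dots> \<le> (norm z ^ k / fact k) / 1"
      using p by (intro divide_left_mono) auto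
    finally show "norm (fps_nth (bessel_fps \<nu>) k * z ^ k) \<le> norm z ^ k /\<^sub>R fact k"
      by (simp add: divide_inverse mult.commute)
  qed
qed

text \<open>Bessel's equation in the variable \<open>z\<^sup>2 / 4\<close>, after removal of the factor \<open>z powr \<nu>\<close>.\<close>

lemma bessel_fps_ode:
  assumes "0 \<le> \<nu>"
  shows "fps_X * fps_deriv (fps_deriv (bessel_fps \<nu>)) + fps_const (of_real (\<nu> + 1)) * fps_deriv (bessel_fps \<nu>)
     + bessel_fps \<nu> = 0"
proof (rule fps_ext)
  fix k
  have p: "pochhammer (\<nu> + 1) j > 0" for j by (rule pochhammer_pos) (use assms in simp)
  define r where "r j = (-1) ^ j / (fact j * pochhammer (\<nu> + 1) j)" for j
  have r: "real (Suc k) * (real k + (\<nu> + 1)) * r (Suc k) + r k = 0"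
    using p[of k] p[of "Suc k"] assms by (simp add: r_def pochhammer_Suc divide_simps)
  have n: "fps_nth (bessel_fps \<nu>) j = of_real (r j)" for j by (simp add: bessel_fps_def r_def)
  have "fps_nth (fps_X * fps_deriv (fps_deriv (bessel_fps \<nu>)) + fps_const (of_real (\<nu> + 1)) * fps_deriv (bessel_fps \<nu>)
     + bessel_fps \<nu>) k = of_real (real (Suc k) * (real k + (\<nu> + 1)) * r (Suc k) + r k)"
    by (cases k) (simp_all add: n algebra_simps)
  then show "fps_nth (fps_X * fps_deriv (fps_deriv (bessel_fps \<nu>)) + fps_const (of_real (\<nu> + 1)) * fps_deriv (bessel_fps \<nu>)
     + bessel_fps \<nu>) k = fps_nth 0 k"
    by (simp only: r of_real_0 fps_zero_nth)
qed

text \<open>Division of Bessel's equation by the function itself leaves a Riccati equation for the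
  logarithmic derivative. Comparing coefficients in it gives Rayleigh's recursion for the power sums
  of the zeros, all of whose terms are nonnegative.\<close>

lemma bessel_riccati:
  assumes "0 \<le> \<nu>"
  defines "u \<equiv> neg_log_deriv (bessel_fps \<nu>)"
  shows "fps_const (of_real (\<nu> + 1)) * u + fps_X * fps_deriv u = 1 + fps_X * (u * u)"
proof -
  define F where "F = bessel_fps \<nu>"
  define c where "c = fps_const (complex_of_real (\<nu> + 1))"
  have F1: "fps_deriv F = - u * F"
    unfolding u_def F_def by (rule fps_deriv_eq_neg_log_deriv[OF bessel_fps_nth_0])
  then have F2: "fps_deriv (fps_deriv F) = - fps_deriv u * F + u * u * F"
    by (simp add: algebra_simps)
  have "F * (1 + fps_X * (u * u) - (c * u + fps_X * fps_deriv u))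
      = fps_X * fps_deriv (fps_deriv F) + c * fps_deriv F + F"
    unfolding F2 unfolding F1 by (simp add: algebra_simps)
  also have "\<dots> = 0" using bessel_fps_ode[OF assms(1)] by (simp add: F_def c_def)
  finally have "1 + fps_X * (u * u) - (c * u + fps_X * fps_deriv u) = 0"
    using bessel_fps_nth_0[of \<nu>] unfolding F_def by (metis fps_zero_nth mult_eq_0_iff zero_neq_one)
  then show ?thesis by (simp add: c_def)
qed

text \<open>Rayleigh's recursion shows that the coefficients are positive, and also that they grow at least
  geometrically. So the radius of convergence is finite, which provides the first zero of the Bessel
  function.\<close>

lemma bessel_fps_rayleigh_positive:
  assumes \<nu>: "0 \<le> \<nu>"
  shows "rayleigh_positive (bessel_fps \<nu>)"
proof -
  define u where "u = neg_log_deriv (bessel_fps \<nu>)"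
  define A where "A = 1 / (\<nu> + 1)"
  define q where "q = A / (\<nu> + 2)"
  have A: "0 < A" and q: "0 < q" using \<nu> by (simp_all add: A_def q_def)
  have rec0: "of_real (\<nu> + 1) * fps_nth u 0 = 1"
  proof -
    have "fps_nth (fps_const (of_real (\<nu> + 1)) * u + fps_X * fps_deriv u) 0 = fps_nth (1 + fps_X * (u * u)) 0"
      unfolding u_def by (simp only: bessel_riccati[OF \<nu>])
    then show ?thesis by simp
  qed
  have rec: "of_real (\<nu> + 1 + real (Suc k)) * fps_nth u (Suc k) = (\<Sum>i=0..k. fps_nth u i * fps_nth u (k - i))" for k
  proof -
    have "fps_nth (fps_const (of_real (\<nu> + 1)) * u + fps_X * fps_deriv u) (Suc k) = fps_nth (1 + fps_X * (u * u)) (Suc k)"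
      unfolding u_def by (simp only: bessel_riccati[OF \<nu>])
    then have "of_real (\<nu> + 1 + real (Suc k)) * fps_nth u (Suc k) = fps_nth (u * u) k"
      by (simp add: algebra_simps)
    then show ?thesis by (simp only: fps_mult_nth)
  qed
  \<comment> \<open>\<open>q\<close> is chosen such that \<open>k * A\<^sup>2 * q ^ (k - 1) \<ge> (\<nu> + 1 + k) * A * q ^ k\<close> for all \<open>k \<ge> 1\<close>\<close>
  have u: "\<exists>y. fps_nth u k = complex_of_real y \<and> A * q ^ k \<le> y" for k
  proof (induction k rule: less_induct)
    case (less k)
    show ?case
    proof (cases k)
      case 0
      have "fps_nth u 0 = of_real A"
        using rec0 \<nu> of_real_eq_0_iff[of "\<nu> + 1", where 'a = complex]
        by (simp add: A_def nonzero_eq_divide_eq mult.commute del: of_real_eq_0_iff)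
      then show ?thesis using 0 by auto
    next
      case (Suc m)
      define y where "y i = Re (fps_nth u i)" for i
      have y: "fps_nth u i = complex_of_real (y i) \<and> A * q ^ i \<le> y i" if "i \<le> m" for i
        using less[of i] Suc that by (auto simp: y_def)
      define Y where "Y = (\<Sum>i=0..m. y i * y (m - i)) / (\<nu> + 1 + real k)"
      have pos: "0 < \<nu> + 1 + real k" using \<nu> by simp
      have "of_real (\<nu> + 1 + real k) * fps_nth u k = complex_of_real (\<Sum>i=0..m. y i * y (m - i))"
        using rec[of m] y Suc by simp
      also have "\<dots> = of_real (\<nu> + 1 + real k) * of_real Y"
        using pos by (simp only: Y_def flip: of_real_mult) simp
      finally have "fps_nth u k = of_real Y" using pos by (metis mult_cancel_left of_real_eq_0_iff less_irrefl)
      moreover have "A * q ^ k \<le> Y"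
      proof -
        have "(\<Sum>i=0..m. A * A * q ^ m) \<le> (\<Sum>i=0..m. y i * y (m - i))"
        proof (rule sum_mono)
          fix i assume "i \<in> {0..m}"
          then have "(A * q ^ i) * (A * q ^ (m - i)) \<le> y i * y (m - i)"
            using y[of i] y[of "m - i"] A q by (intro mult_mono) (auto intro: order_trans[rotated])
          moreover have "q ^ i * q ^ (m - i) = q ^ m"
            using \<open>i \<in> {0..m}\<close> by (simp flip: power_add)
          ultimately show "A * A * q ^ m \<le> y i * y (m - i)"
            by (metis mult.assoc mult.left_commute)
        qed
        moreover have "A * q ^ k * (\<nu> + 1 + real k) \<le> (\<Sum>i=0..m. A * A * q ^ m)"
        proof -
          have "\<nu> + 1 + real k \<le> (\<nu> + 2) * real k"
            using \<nu> Suc mult_left_mono[of 1 "real k" "\<nu> + 1"] by (simp add: algebra_simps)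
          then have "q * (\<nu> + 1 + real k) \<le> q * ((\<nu> + 2) * real k)"
            using q by (intro mult_left_mono) auto
          also have "\<dots> = A * real k" using \<nu> by (simp add: q_def)
          finally have "A * q ^ m * (q * (\<nu> + 1 + real k)) \<le> A * q ^ m * (A * real k)"
            using A q by (intro mult_left_mono) auto
          then show ?thesis by (simp add: Suc algebra_simps)
        qed
        ultimately have "A * q ^ k * (\<nu> + 1 + real k) \<le> (\<Sum>i=0..m. y i * y (m - i))" by simp
        then show ?thesis using pos by (simp add: Y_def pos_le_divide_eq)
      qed
      ultimately show ?thesis by blast
    qed
  qed
  have "nonneg_coeffs u"
    unfolding nonneg_coeffs_def
  proof
    fix k
    obtain y where y: "fps_nth u k = complex_of_real y" "A * q ^ k \<le> y" using u by blast
    have "0 \<le> A * q ^ k" using A q by simp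
    with y show "fps_nth u k \<in> \<real>\<^sub>\<ge>\<^sub>0" by simp
  qed
  moreover have "fps_conv_radius u \<le> ereal (1 / q)"
  proof (rule ccontr)
    assume "\<not> ?thesis"
    then have "summable (\<lambda>k. fps_nth u k * of_real (1 / q) ^ k)"
      using q by (intro summable_fps) (simp add: not_le norm_divide)
    then have "(\<lambda>k. fps_nth u k * of_real (1 / q) ^ k) \<longlonglongrightarrow> 0" by (rule summable_LIMSEQ_zero)
    then have "(\<lambda>k. norm (fps_nth u k * of_real (1 / q) ^ k)) \<longlonglongrightarrow> 0" by (rule tendsto_norm_zero)
    moreover have "A \<le> norm (fps_nth u k * of_real (1 / q) ^ k)" for k
    proof -
      obtain y where y: "fps_nth u k = complex_of_real y" "A * q ^ k \<le> y" using u by blast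
      have "A = A * q ^ k * (1 / q) ^ k" using q by (simp add: power_one_over)
      also have "\<dots> \<le> y * (1 / q) ^ k" using y q by (intro mult_right_mono) auto
      also have "\<dots> \<le> norm (fps_nth u k * of_real (1 / q) ^ k)"
        using q by (simp add: y norm_mult norm_divide norm_power mult_right_mono divide_right_mono)
      finally show ?thesis .
    qed
    ultimately have "A \<le> 0" using LIMSEQ_le_const by blast
    with A show False by simp
  qed
  then have "fps_conv_radius u < \<infinity>" by (rule le_less_trans) simp
  ultimately show ?thesis
    unfolding rayleigh_positive_def u_def using bessel_fps_radius[OF \<nu>] bessel_fps_nth_0 by blast
qed

section \<open>The series of \<open>N\<^sub>\<nu>\<close>\<close>

text \<open>Solutions in the manner of Frobenius: a power of \<open>z\<close> times a power series, in the variable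
  \<open>z\<^sup>2 / 4\<close>.\<close>

definition frobenius :: "real \<Rightarrow> complex fps \<Rightarrow> complex \<Rightarrow> complex" where
  "frobenius \<nu> A z = z powr of_real \<nu> * eval_fps A (z\<^sup>2 / 4)"

text \<open>The action of \<open>z d/dz\<close> on the series \<open>A\<close> in \<open>frobenius \<nu> A\<close>: the power contributes \<open>\<nu>\<close>, and
  \<open>z d/dz\<close> is \<open>2 X d/dX\<close> in the variable \<open>X = z\<^sup>2 / 4\<close>.\<close>

definition euler_op :: "real \<Rightarrow> complex fps \<Rightarrow> complex fps" where
  "euler_op \<nu> A = fps_const (of_real \<nu>) * A + 2 * fps_X * fps_deriv A"

lemma entire_euler_op: "fps_conv_radius A = \<infinity> \<Longrightarrow> fps_conv_radius (euler_op \<nu> A) = \<infinity>"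
  unfolding euler_op_def by (intro entire_intros)

lemma eval_euler_op:
  "fps_conv_radius A = \<infinity> \<Longrightarrow>
    eval_fps (euler_op \<nu> A) w = of_real \<nu> * eval_fps A w + 2 * w * eval_fps (fps_deriv A) w"
  by (simp add: euler_op_def eval_fps_add eval_fps_mult entire_intros)

lemma frobenius_add:
  "fps_conv_radius A = \<infinity> \<Longrightarrow> fps_conv_radius B = \<infinity> \<Longrightarrow> frobenius \<nu> (A + B) z = frobenius \<nu> A z + frobenius \<nu> B z"
  by (simp add: frobenius_def eval_fps_add algebra_simps)

lemma frobenius_diff:
  "fps_conv_radius A = \<infinity> \<Longrightarrow> fps_conv_radius B = \<infinity> \<Longrightarrow> frobenius \<nu> (A - B) z = frobenius \<nu> A z - frobenius \<nu> B z"
  by (simp add: frobenius_def eval_fps_diff algebra_simps)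

lemma frobenius_cmult:
  "fps_conv_radius A = \<infinity> \<Longrightarrow> frobenius \<nu> (fps_const c * A) z = c * frobenius \<nu> A z"
  by (simp add: frobenius_def eval_fps_mult algebra_simps)

lemma has_field_derivative_frobenius:
  assumes A: "fps_conv_radius A = \<infinity>" and z: "0 < Re z"
  shows "(frobenius \<nu> A has_field_derivative frobenius \<nu> (euler_op \<nu> A) z / z) (at z)"
proof -
  have z0: "z \<noteq> 0" "z \<notin> \<real>\<^sub>\<le>\<^sub>0" using z by (auto simp: complex_nonpos_Reals_iff)
  have p: "((\<lambda>z. z powr of_real \<nu>) has_field_derivative of_real \<nu> * (z powr of_real \<nu> / z)) (at z)"
    using has_field_derivative_powr[OF z0(2), of "of_real \<nu>"] z0 by (simp add: powr_diff)
  have e: "((\<lambda>z. eval_fps A (z\<^sup>2 / 4)) has_field_derivative eval_fps (fps_deriv A) (z\<^sup>2 / 4) * (z / 2)) (at z)"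
  proof (rule DERIV_chain2[of "eval_fps A"])
    show "(eval_fps A has_field_derivative eval_fps (fps_deriv A) (z\<^sup>2 / 4)) (at (z\<^sup>2 / 4))"
      by (rule has_field_derivative_eval_fps) (simp add: A)
    show "((\<lambda>z. z\<^sup>2 / 4) has_field_derivative z / 2) (at z)"
      by (auto intro!: derivative_eq_intros)
  qed
  have "frobenius \<nu> (euler_op \<nu> A) z / z = of_real \<nu> * (z powr of_real \<nu> / z) * eval_fps A (z\<^sup>2 / 4)
      + eval_fps (fps_deriv A) (z\<^sup>2 / 4) * (z / 2) * z powr of_real \<nu>"
    using z0 by (simp add: frobenius_def eval_euler_op[OF A] field_simps power2_eq_square)
  then show ?thesis
    unfolding frobenius_def[of \<nu> A, abs_def] using DERIV_mult[OF p e] by simp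
qed

text \<open>The operator \<open>z d/dz\<close> acts on the coefficient series as \<open>euler_op \<nu>\<close>, so \<open>z\<^sup>2\<close> times the second
  derivative acts as \<open>euler_op \<nu>\<close> applied twice, minus \<open>euler_op \<nu>\<close>. The right half-plane is used since
  the principal power is holomorphic there.\<close>

lemma deriv_right_half_plane:
  assumes A: "fps_conv_radius A = \<infinity>" and N: "\<And>z. 0 < Re z \<Longrightarrow> N z = C * frobenius \<nu> A z" and z: "0 < Re z"
  shows "z * deriv N z = C * frobenius \<nu> (euler_op \<nu> A) z"
    and "z\<^sup>2 * deriv (deriv N) z = C * frobenius \<nu> (euler_op \<nu> (euler_op \<nu> A) - euler_op \<nu> A) z"
proof -
  have d1: "deriv N z = C * (frobenius \<nu> (euler_op \<nu> A) z / z)" if z: "0 < Re z" for z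
  proof -
    have "((\<lambda>z. C * frobenius \<nu> A z) has_field_derivative C * (frobenius \<nu> (euler_op \<nu> A) z / z)) (at z)"
      by (rule DERIV_cmult[OF has_field_derivative_frobenius[OF A z]])
    then have "(N has_field_derivative C * (frobenius \<nu> (euler_op \<nu> A) z / z)) (at z)"
      by (rule has_field_derivative_transform_within_open[where S = "{z. 0 < Re z}"])
        (use z N in \<open>auto simp: open_halfspace_Re_gt\<close>)
    then show ?thesis by (rule DERIV_imp_deriv)
  qed
  have z0: "z \<noteq> 0" using z by auto
  then show "z * deriv N z = C * frobenius \<nu> (euler_op \<nu> A) z" using d1[OF z] by simp
  have A': "fps_conv_radius (euler_op \<nu> A) = \<infinity>" by (rule entire_euler_op[OF A])
  have "((\<lambda>z. C * (frobenius \<nu> (euler_op \<nu> A) z / z)) has_field_derivative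
     C * ((frobenius \<nu> (euler_op \<nu> (euler_op \<nu> A)) z / z * z - frobenius \<nu> (euler_op \<nu> A) z * 1) / (z * z))) (at z)"
    by (rule DERIV_cmult[OF DERIV_divide[OF has_field_derivative_frobenius[OF A' z] DERIV_ident z0]])
  then have "(deriv N has_field_derivative
     C * ((frobenius \<nu> (euler_op \<nu> (euler_op \<nu> A)) z / z * z - frobenius \<nu> (euler_op \<nu> A) z * 1) / (z * z))) (at z)"
    by (rule has_field_derivative_transform_within_open[where S = "{z. 0 < Re z}"])
      (use z d1 in \<open>auto simp: open_halfspace_Re_gt\<close>)
  then have "deriv (deriv N) z =
     C * ((frobenius \<nu> (euler_op \<nu> (euler_op \<nu> A)) z / z * z - frobenius \<nu> (euler_op \<nu> A) z * 1) / (z * z))"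
    by (rule DERIV_imp_deriv)
  then show "z\<^sup>2 * deriv (deriv N) z = C * frobenius \<nu> (euler_op \<nu> (euler_op \<nu> A) - euler_op \<nu> A) z"
    using z0 by (simp add: frobenius_diff entire_euler_op A power2_eq_square)
qed

lemma bessel_J_eq_frobenius:
  assumes \<nu>: "0 \<le> \<nu>" and z: "0 < Re z"
  shows "bessel_J \<nu> z = of_real (1 / (2 powr \<nu> * Gamma (\<nu> + 1))) * frobenius \<nu> (bessel_fps \<nu>) z"
proof -
  have z0: "z \<noteq> 0" using z by auto
  define c where "c = complex_of_real (1 / (2 powr \<nu> * Gamma (\<nu> + 1)))"
  have G: "Gamma (\<nu> + 1) > 0" using \<nu> by (intro Gamma_real_pos) simp
  have half: "(z / 2) powr of_real \<nu> = of_real (1 / 2 powr \<nu>) * z powr of_real \<nu>"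
  proof -
    have "Ln (z / of_real 2) = Ln z - of_real (ln 2)" by (rule Ln_divide_of_real) (use z0 in auto)
    then have "(z / 2) powr of_real \<nu> = exp (of_real \<nu> * Ln z) / exp (of_real (\<nu> * ln 2))"
      using z0 by (simp add: powr_def right_diff_distrib exp_diff)
    also have "exp (of_real (\<nu> * ln 2)) = complex_of_real (2 powr \<nu>)"
      unfolding exp_of_real by (simp add: powr_def)
    finally show ?thesis using z0 by (simp add: powr_def)
  qed
  have t: "of_real ((-1) ^ n / (fact n * Gamma (real n + \<nu> + 1))) * (z / 2) powr of_real (2 * real n + \<nu>)
      = c * z powr of_real \<nu> * (fps_nth (bessel_fps \<nu>) n * (z\<^sup>2 / 4) ^ n)" for n
  proof -
    have "\<nu> + 1 \<notin> \<int>\<^sub>\<le>\<^sub>0" using \<nu> by (auto elim!: nonpos_Ints_cases)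
    then have g: "Gamma (real n + \<nu> + 1) = pochhammer (\<nu> + 1) n * Gamma (\<nu> + 1)"
      using pochhammer_Gamma[of "\<nu> + 1" n] G by (simp add: field_simps)
    have "(z / 2) powr of_real (2 * real n + \<nu>) = (z / 2) powr (of_nat (2 * n)) * (z / 2) powr of_real \<nu>"
      by (simp add: powr_add)
    also have "(z / 2) powr (of_nat (2 * n)) = (z\<^sup>2 / 4) ^ n"
      using z0 by (subst powr_complexpow) (simp_all add: power_mult power_divide)
    finally show ?thesis
      by (simp add: g half c_def bessel_fps_def mult_ac)
  qed
  have "(\<lambda>n. fps_nth (bessel_fps \<nu>) n * (z\<^sup>2 / 4) ^ n) sums eval_fps (bessel_fps \<nu>) (z\<^sup>2 / 4)"
    by (rule sums_eval_fps) (simp add: bessel_fps_radius[OF \<nu>])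
  then have "(\<lambda>n. c * z powr of_real \<nu> * (fps_nth (bessel_fps \<nu>) n * (z\<^sup>2 / 4) ^ n)) sums
      (c * z powr of_real \<nu> * eval_fps (bessel_fps \<nu>) (z\<^sup>2 / 4))"
    by (rule sums_mult)
  then show ?thesis
    unfolding bessel_J_def t c_def[symmetric] frobenius_def by (simp add: sums_iff)
qed

lemma norm_const_bessel_N:
  assumes \<nu>: "0 \<le> \<nu>" and Q: "Q_poly a b c \<nu> \<noteq> 0" and M: "fps_conv_radius M = \<infinity>"
    and QM: "fps_const (of_real (Q_poly a b c \<nu>)) * M =
      fps_const (of_real a) * (euler_op \<nu> (euler_op \<nu> (bessel_fps \<nu>)) - euler_op \<nu> (bessel_fps \<nu>))
      + fps_const (of_real b) * euler_op \<nu> (bessel_fps \<nu>) + fps_const (of_real c) * bessel_fps \<nu>"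
    and z: "0 < Re z"
  shows "bessel_N a b c \<nu> z = inverse (norm_const a b c \<nu>) * frobenius \<nu> M z"
proof -
  define F where "F = bessel_fps \<nu>"
  define k where "k = complex_of_real (1 / (2 powr \<nu> * Gamma (\<nu> + 1)))"
  have F: "fps_conv_radius F = \<infinity>" unfolding F_def by (rule bessel_fps_radius[OF \<nu>])
  note J = bessel_J_eq_frobenius[OF \<nu>, folded F_def k_def]
  have d: "z * deriv (bessel_J \<nu>) z = k * frobenius \<nu> (euler_op \<nu> F) z"
    "z\<^sup>2 * deriv (deriv (bessel_J \<nu>)) z = k * frobenius \<nu> (euler_op \<nu> (euler_op \<nu> F) - euler_op \<nu> F) z"
    by (rule deriv_right_half_plane[OF F _ z], rule J, assumption)+
  have "bessel_N a b c \<nu> z = of_real a * (z\<^sup>2 * deriv (deriv (bessel_J \<nu>)) z)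
      + of_real b * (z * deriv (bessel_J \<nu>) z) + of_real c * bessel_J \<nu> z"
    by (simp add: bessel_N_def)
  also have "\<dots> = k * frobenius \<nu> (fps_const (of_real a) * (euler_op \<nu> (euler_op \<nu> F) - euler_op \<nu> F)
      + fps_const (of_real b) * euler_op \<nu> F + fps_const (of_real c) * F) z"
    unfolding d J[OF z]
    by (simp only: frobenius_add frobenius_diff frobenius_cmult entire_intros entire_euler_op F)
      (simp add: algebra_simps)
  also have "\<dots> = k * of_real (Q_poly a b c \<nu>) * frobenius \<nu> M z"
    unfolding QM[folded F_def, symmetric] by (simp add: frobenius_cmult M)
  also have "k * of_real (Q_poly a b c \<nu>) = inverse (norm_const a b c \<nu>)"
    by (simp add: k_def norm_const_def)
  finally show ?thesis .
qed

text \<open>Bessel's equation \<open>(z d/dz)\<^sup>2 J = (\<nu>\<^sup>2 - z\<^sup>2) J\<close>, where \<open>z\<^sup>2 = 4 X\<close>.\<close>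

lemma euler_op_bessel_fps:
  assumes "0 \<le> \<nu>"
  shows "euler_op \<nu> (euler_op \<nu> (bessel_fps \<nu>)) = fps_const (of_real (\<nu>\<^sup>2)) * bessel_fps \<nu> - 4 * fps_X * bessel_fps \<nu>"
proof -
  define F where "F = bessel_fps \<nu>"
  have c: "fps_const (complex_of_real (\<nu> + 1)) = fps_const (of_real \<nu>) + 1"
    by (simp flip: fps_const_add)
  have c2: "fps_const (complex_of_real (\<nu>\<^sup>2)) = fps_const (of_real \<nu>) * fps_const (of_real \<nu>)"
    by (simp add: power2_eq_square)
  have "euler_op \<nu> (euler_op \<nu> F) = fps_const (of_real (\<nu>\<^sup>2)) * F - 4 * fps_X * F
     + 4 * fps_X * (fps_X * fps_deriv (fps_deriv F) + fps_const (of_real (\<nu> + 1)) * fps_deriv F + F)"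
    unfolding euler_op_def c c2 by (simp add: algebra_simps)
  then show ?thesis using bessel_fps_ode[OF assms] by (simp add: F_def)
qed

lemma roots_le_max_0_nu0:
  assumes nz: "Q_poly a b c \<nu> \<noteq> 0" and r: "Q_poly a b c x = 0"
  shows "x \<le> max_0_nu0 a b c"
proof -
  define p where "p = [:c, b - a, a:]"
  have p: "poly p y = Q_poly a b c y" for y
    by (simp add: p_def Q_poly_def algebra_simps)
  have "p \<noteq> 0" using nz p[of \<nu>] by auto
  then have "finite {y. Q_poly a b c y = 0}" using poly_roots_finite[of p] by (simp add: p)
  then have "x \<le> nu0 a b c" unfolding nu0_def using r by (intro Max_ge) auto
  then show ?thesis using r by (auto simp: max_0_nu0_def)
qed

text \<open>In the first case, Bessel's equation reduces \<open>N\<^sub>\<nu>\<close> to a first-order expression in \<open>J\<^sub>\<nu>\<close> whose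
  coefficients have the right signs; polynomials \<open>Q\<close> without real roots belong here. In the second
  case, \<open>Q\<close> splits over the reals and each linear factor can be treated separately.\<close>

lemma Q_poly_root_cases:
  assumes h: "(c = 0 \<and> a \<noteq> b) \<or> (c > 0 \<and> a < b)" and Q: "Q_poly a b c \<nu> \<noteq> 0" and \<nu>: "max_0_nu0 a b c \<le> \<nu>"
  shows "(0 < (b - a) / Q_poly a b c \<nu> \<and> 0 \<le> a / Q_poly a b c \<nu>) \<or>
    (\<exists>x y. x < \<nu> \<and> y < \<nu> \<and> a \<noteq> 0 \<and> (\<forall>t. Q_poly a b c t = a * (t - x) * (t - y)))"
proof -
  have root: "x < \<nu>" if "Q_poly a b c x = 0" for x
    using roots_le_max_0_nu0[OF Q that] \<nu> Q that by (metis less_eq_real_def order_trans)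
  have \<nu>0: "0 \<le> \<nu>" using \<nu> by (auto simp: max_0_nu0_def split: if_splits)
  show ?thesis
  proof (cases "c = 0")
    case c: True
    have "0 < \<nu>" using root[of 0] c by (simp add: Q_poly_def)
    show ?thesis
    proof (cases "a = 0")
      case True
      then show ?thesis using c h \<open>0 < \<nu>\<close> by (simp add: Q_poly_def)
    next
      case False
      have f: "Q_poly a b c t = a * (t - 0) * (t - (a - b) / a)" for t
        using False c by (simp add: Q_poly_def field_simps)
      then have "(a - b) / a < \<nu>" by (intro root) simp
      then show ?thesis using f False \<open>0 < \<nu>\<close> by blast
    qed
  next
    case False
    then have c: "0 < c" "a < b" using h by auto
    show ?thesis
    proof (cases "0 \<le> a")
      case True
      have "Q_poly a b c \<nu> = a * \<nu>\<^sup>2 + (b - a) * \<nu> + c" by (simp add: Q_poly_def algebra_simps power2_eq_square)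
      also have "\<dots> > 0" using True c \<nu>0 by (intro add_nonneg_pos add_nonneg_nonneg mult_nonneg_nonneg) auto
      finally show ?thesis using True c by simp
    next
      case a: False
      define s where "s = sqrt ((b - a)\<^sup>2 - 4 * a * c)"
      have "0 \<le> (b - a)\<^sup>2 - 4 * a * c" using mult_nonpos_nonneg[of a c] zero_le_power2[of "b - a"] a c by linarith
      then have s: "s * s = (b - a)\<^sup>2 - 4 * a * c" by (simp add: s_def)
      define x y where "x = (a - b + s) / (2 * a)" and "y = (a - b - s) / (2 * a)"
      have f: "Q_poly a b c t = a * (t - x) * (t - y)" for t
      proof -
        have sum: "a * (x + y) = a - b" using a by (simp add: x_def y_def field_simps)
        have "x * y = c / a"
        proof -
          have "x * y = ((a - b) * (a - b) - s * s) / (4 * a * a)" by (simp add: x_def y_def field_simps)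
          then show ?thesis using a by (simp add: s power2_eq_square field_simps)
        qed
        then have prod: "a * (x * y) = c" using a by simp
        have "a * (t - x) * (t - y) = a * t * t - a * (x + y) * t + a * (x * y)" by (simp add: algebra_simps)
        then show ?thesis unfolding sum prod by (simp add: Q_poly_def algebra_simps)
      qed
      have "x < \<nu>" "y < \<nu>" by (intro root; simp add: f)+
      then show ?thesis using f a by force
    qed
  qed
qed

lemma fps_const_mult_theta_step:
  "x \<noteq> 0 \<Longrightarrow> fps_const (of_real x) * theta_step (2 / x) 0 A = euler_op x A"
proof -
  assume x: "x \<noteq> 0"
  have "fps_const (complex_of_real x) * fps_const (of_real (2 / x)) = 2"
    using x by (simp add: fps_numeral_fps_const)
  then have "fps_const (complex_of_real x) * (fps_const (of_real (2 / x)) * (fps_X * fps_deriv A)) = 2 * (fps_X * fps_deriv A)"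
    by (simp only: mult.assoc[symmetric])
  then show ?thesis by (simp add: theta_step_def euler_op_def algebra_simps)
qed

lemma euler_op_shift: "euler_op (\<nu> - x) A = euler_op \<nu> A - fps_const (of_real x) * A"
  by (simp add: euler_op_def algebra_simps flip: fps_const_sub)

lemma euler_op_linear: "euler_op \<nu> (A - fps_const k * B) = euler_op \<nu> A - fps_const k * euler_op \<nu> B"
  by (simp add: euler_op_def algebra_simps)

text \<open>The normalised series of \<open>N\<^sub>\<nu>\<close> has \<open>Q (2 k + \<nu>) / Q (\<nu>)\<close> times the coefficients of the Bessel
  series. In the first case this is one step with \<open>s = 2 (b - a) / Q (\<nu>)\<close> and \<open>t = 4 a / Q (\<nu>)\<close>, where
  \<open>t\<close> comes from the term \<open>- a z\<^sup>2\<close> that Bessel's equation produces. In the second case the factor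
  \<open>2 k + \<nu> - x\<close> that belongs to a root \<open>x\<close> is, up to a constant, the step with \<open>s = 2 / (\<nu> - x)\<close> and
  \<open>t = 0\<close>.\<close>

lemma normalized_series_exists:
  assumes h: "(c = 0 \<and> a \<noteq> b) \<or> (c > 0 \<and> a < b)" and Q: "Q_poly a b c \<nu> \<noteq> 0" and \<nu>: "max_0_nu0 a b c \<le> \<nu>"
  obtains M where "rayleigh_positive M"
    and "\<And>z. 0 < Re z \<Longrightarrow> bessel_N a b c \<nu> z = inverse (norm_const a b c \<nu>) * frobenius \<nu> M z"
proof -
  define F where "F = bessel_fps \<nu>"
  define q where "q = Q_poly a b c \<nu>"
  have \<nu>0: "0 \<le> \<nu>" using \<nu> by (auto simp: max_0_nu0_def split: if_splits)
  have F: "rayleigh_positive F" unfolding F_def by (rule bessel_fps_rayleigh_positive[OF \<nu>0])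
  have q: "q \<noteq> 0" using Q by (simp add: q_def)
  have "\<exists>M. rayleigh_positive M \<and> fps_const (of_real q) * M =
      fps_const (of_real a) * (euler_op \<nu> (euler_op \<nu> F) - euler_op \<nu> F)
      + fps_const (of_real b) * euler_op \<nu> F + fps_const (of_real c) * F"
    using Q_poly_root_cases[OF h Q \<nu>]
  proof
    assume c: "0 < (b - a) / Q_poly a b c \<nu> \<and> 0 \<le> a / Q_poly a b c \<nu>"
    define s t where "s = 2 * ((b - a) / q)" and "t = 4 * (a / q)"
    have "0 < s" unfolding s_def q_def by (rule mult_pos_pos) (use c in auto)
    moreover have "0 \<le> t" unfolding t_def q_def by (rule mult_nonneg_nonneg) (use c in auto)
    ultimately have st: "0 < s" "0 \<le> t" .
    define ca cb where "ca = fps_const (complex_of_real a)" and "cb = fps_const (complex_of_real b)"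
    have qt: "q * t = 4 * a" and qs: "q * s = 2 * (b - a)" using q by (simp_all add: t_def s_def)
    have e1: "fps_const (complex_of_real q) * fps_const (of_real t) = 4 * fps_const (of_real a)"
      unfolding fps_const_mult of_real_mult[symmetric] qt by (simp add: fps_numeral_fps_const)
    have e2: "fps_const (complex_of_real q) * fps_const (of_real s)
        = 2 * (fps_const (of_real b) - fps_const (of_real a))"
      unfolding fps_const_mult of_real_mult[symmetric] qs by (simp add: fps_numeral_fps_const)
    have e3: "fps_const (complex_of_real q) = fps_const (of_real a) * fps_const (of_real (\<nu>\<^sup>2))
        + (fps_const (of_real b) - fps_const (of_real a)) * fps_const (of_real \<nu>) + fps_const (of_real c)"
      by (simp add: q_def Q_poly_def power2_eq_square algebra_simps)
    have "fps_const (of_real q) * theta_step s t F = fps_const (of_real q) * F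
        - (fps_const (of_real q) * fps_const (of_real t)) * (fps_X * F)
        + (fps_const (of_real q) * fps_const (of_real s)) * (fps_X * fps_deriv F)"
      unfolding theta_step_def by (simp only: ring_distribs mult.assoc)
    also have "\<dots> = fps_const (of_real a) * (euler_op \<nu> (euler_op \<nu> F) - euler_op \<nu> F)
      + fps_const (of_real b) * euler_op \<nu> F + fps_const (of_real c) * F"
      unfolding F_def euler_op_bessel_fps[OF \<nu>0] e1 e2
      unfolding euler_op_def e3 ca_def[symmetric] cb_def[symmetric] by (simp add: algebra_simps)
    finally show ?thesis using theta_step_rayleigh_positive(1)[OF F st] by blast
  next
    assume "\<exists>x y. x < \<nu> \<and> y < \<nu> \<and> a \<noteq> 0 \<and> (\<forall>t. Q_poly a b c t = a * (t - x) * (t - y))"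
    then obtain x y where xy: "x < \<nu>" "y < \<nu>" "a \<noteq> 0" and f: "\<And>t. Q_poly a b c t = a * (t - x) * (t - y)"
      by blast
    define M where "M = theta_step (2 / (\<nu> - x)) 0 (theta_step (2 / (\<nu> - y)) 0 F)"
    have "fps_const (of_real q) * M = fps_const (of_real a) * (euler_op (\<nu> - x) (euler_op (\<nu> - y) F))"
    proof -
      define L where "L = theta_step (2 / (\<nu> - y)) 0 F"
      have qe: "fps_const (complex_of_real q) = fps_const (of_real a) * fps_const (of_real (\<nu> - x)) * fps_const (of_real (\<nu> - y))"
        unfolding q_def f by (simp add: mult.assoc)
      have "fps_const (complex_of_real q) * M
          = fps_const (of_real a) * fps_const (of_real (\<nu> - y)) * (fps_const (of_real (\<nu> - x)) * theta_step (2 / (\<nu> - x)) 0 L)"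
        unfolding qe M_def L_def by (simp only: mult_ac)
      also have "\<dots> = fps_const (of_real a) * (fps_const (of_real (\<nu> - y)) * euler_op (\<nu> - x) L)"
        using xy by (subst fps_const_mult_theta_step) (simp_all add: mult.assoc)
      also have "fps_const (of_real (\<nu> - y)) * euler_op (\<nu> - x) L = euler_op (\<nu> - x) (fps_const (of_real (\<nu> - y)) * L)"
        by (simp add: euler_op_def algebra_simps del: of_real_diff)
      also have "fps_const (of_real (\<nu> - y)) * L = euler_op (\<nu> - y) F"
        unfolding L_def using xy by (intro fps_const_mult_theta_step) simp
      finally show ?thesis .
    qed
    also have "\<dots> = fps_const (of_real a) * (euler_op \<nu> (euler_op \<nu> F) - euler_op \<nu> F)
      + fps_const (of_real b) * euler_op \<nu> F + fps_const (of_real c) * F"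
    proof -
      have c: "c = a * x * y" using f[of 0] by (simp add: Q_poly_def)
      have b: "b = a - a * (x + y)" using f[of 1] c by (simp add: Q_poly_def algebra_simps)
      have "fps_const (complex_of_real c) = fps_const (of_real a) * fps_const (of_real x) * fps_const (of_real y)"
        "fps_const (complex_of_real b) = fps_const (of_real a)
          - fps_const (of_real a) * (fps_const (of_real x) + fps_const (of_real y))"
        by (simp_all add: c b algebra_simps)
      then show ?thesis
        unfolding euler_op_shift euler_op_linear by (simp only:) (simp only: algebra_simps)
    qed
    finally have "fps_const (of_real q) * M = fps_const (of_real a) * (euler_op \<nu> (euler_op \<nu> F) - euler_op \<nu> F)
      + fps_const (of_real b) * euler_op \<nu> F + fps_const (of_real c) * F" .
    moreover have "rayleigh_positive M"
      unfolding M_def using xy by (intro theta_step_rayleigh_positive(1)[OF _ divide_pos_pos order_refl] F) auto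
    ultimately show ?thesis by blast
  qed
  then obtain M where M: "rayleigh_positive M" and "fps_const (of_real q) * M =
      fps_const (of_real a) * (euler_op \<nu> (euler_op \<nu> F) - euler_op \<nu> F)
      + fps_const (of_real b) * euler_op \<nu> F + fps_const (of_real c) * F"
    by blast
  then show thesis
    using norm_const_bessel_N[OF \<nu>0 Q rayleigh_positive_entire[OF M]] that unfolding q_def F_def by blast
qed

section \<open>The radius of convexity\<close>

text \<open>Uniqueness in the definition of \<open>normalized_germ\<close> is the identity theorem, applied to an interval
  \<open>(0, \<epsilon>)\<close>, which accumulates at 0.\<close>

lemma normalized_germ_eq:
  assumes R: "0 < R" and hol: "f holomorphic_on ball 0 R" and f0: "f 0 = 0" "deriv f 0 = 1"
    and ev: "\<forall>\<^sub>F x in at_right (0::real). \<phi> (of_real x) = f (of_real x)"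
  shows "normalized_germ \<phi> = fps_expansion f 0"
proof -
  define F where "F = fps_expansion f 0"
  have hol': "f holomorphic_on eball 0 (ereal R)" using hol by simp
  have rF: "ereal R \<le> fps_conv_radius F"
    unfolding F_def by (rule conv_radius_fps_expansion[OF hol'])
  have eF: "eval_fps F z = f z" if "norm z < R" for z
    using eval_fps_expansion'[OF hol', of z] that by (simp add: F_def)
  have pos: "0 < fps_conv_radius F" using rF R less_le_trans[of 0 "ereal R"] by simp
  have evR: "\<forall>\<^sub>F x in at_right (0::real). x < R"
    using R by (auto simp: eventually_at_right_field)
  have agree: "\<forall>\<^sub>F x in at_right (0::real). eval_fps F (of_real x) = \<phi> (of_real x)"
    using ev evR eventually_at_right_less[of 0]
    by eventually_elim (simp add: eF)
  show ?thesis
    unfolding normalized_germ_def F_def[symmetric]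
  proof (rule the_equality)
    show "0 < fps_conv_radius F \<and> fps_nth F 0 = 0 \<and> fps_nth F 1 = 1 \<and>
      (\<forall>\<^sub>F x in at_right (0::real). eval_fps F (of_real x) = \<phi> (of_real x))"
      using pos agree f0 by (simp add: F_def fps_expansion_def)
  next
    fix H
    assume H: "0 < fps_conv_radius H \<and> fps_nth H 0 = 0 \<and> fps_nth H 1 = 1 \<and>
      (\<forall>\<^sub>F x in at_right (0::real). eval_fps H (of_real x) = \<phi> (of_real x))"
    have "\<forall>\<^sub>F x in at_right (0::real). eval_fps H (of_real x) = eval_fps F (of_real x)"
      using agree H[THEN conjunct2, THEN conjunct2, THEN conjunct2] by eventually_elim simp
    then obtain d where d: "0 < d" "\<And>x. 0 < x \<Longrightarrow> x < d \<Longrightarrow> eval_fps H (of_real x) = eval_fps F (of_real x)"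
      by (auto simp: eventually_at_right_field)
    obtain r where r: "0 < r" "ereal r < fps_conv_radius H" "ereal r < fps_conv_radius F"
      using H pos ereal_dense2[of 0 "min (fps_conv_radius H) (fps_conv_radius F)"] by auto
    have "eval_fps H w - eval_fps F w = 0" if w: "w \<in> ball 0 r" for w
    proof (rule analytic_continuation[where f = "\<lambda>w. eval_fps H w - eval_fps F w" and S = "ball 0 r" and U = "of_real ` {0<..<min d r}" and \<xi> = 0])
      have "ball 0 r \<subseteq> eball 0 (fps_conv_radius H)" "ball 0 r \<subseteq> eball 0 (fps_conv_radius F)"
        by (rule ball_eball_mono, use r in simp)+
      then show "(\<lambda>w. eval_fps H w - eval_fps F w) holomorphic_on ball 0 r"
        by (intro holomorphic_intros)
      show "complex_of_real ` {0<..<min d r} \<subseteq> ball 0 r" by auto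
      show "0 islimpt (complex_of_real ` {0<..<min d r})"
        unfolding islimpt_approachable
      proof (intro allI impI)
        fix e :: real assume e: "0 < e"
        define x where "x = min (min d r) e / 2"
        have "0 < x" "x < min d r" "x < e" using e d r by (auto simp: x_def min_def)
        then show "\<exists>x'\<in>complex_of_real ` {0<..<min d r}. x' \<noteq> 0 \<and> dist x' 0 < e"
          by (intro bexI[of _ "of_real x"]) auto
      qed
    qed (use d r w in auto)
    moreover have "\<forall>\<^sub>F w in nhds 0. w \<in> ball (0::complex) r"
      using r by (intro eventually_nhds_in_open) auto
    ultimately have "\<forall>\<^sub>F w in nhds 0. eval_fps H w = eval_fps F w"
      by (auto elim: eventually_mono)
    then show "H = F" using H pos by (intro eval_fps_eqD) auto
  qed
qed

text \<open>The common core of the three parts. The hypotheses say that \<open>f' (z) = P (z ^ e / 4)\<close> and that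
  \<open>A = - X P' / P\<close> has nonnegative coefficients, and they give \<open>1 + z f'' / f' = 1 - e A (z ^ e / 4)\<close>.
  On the circle of radius \<open>x\<close> the real part of the right-hand side is at least its value at the point \<open>x\<close>.
  This value decreases with \<open>x\<close> and is unbounded below before \<open>P\<close> has a zero, so the convexity radius
  is the first \<open>r\<close> at which it equals \<open>\<beta>\<close>.\<close>

lemma convexity_radius_eq_first_root:
  fixes \<beta> \<rho> :: real and e :: nat
  assumes e: "0 < e" and \<beta>: "\<beta> < 1" and \<rho>: "0 < \<rho>"
    and A: "nonneg_coeffs A" "fps_nth A 0 = 0" "ereal \<rho> \<le> fps_conv_radius A"
    and unb: "\<And>K. \<exists>x\<in>{0..<\<rho>}. K < real_eval A x"
    and P0: "P 0 = 1" and Pnz: "\<And>w. norm w < \<rho> \<Longrightarrow> P w \<noteq> 0"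
    and P': "\<And>w. norm w < \<rho> \<Longrightarrow> (P has_field_derivative dP w) (at w)"
    and PA: "\<And>w. norm w < \<rho> \<Longrightarrow> w * dP w = - eval_fps A w * P w"
    and f0: "f 0 = 0"
    and f': "\<And>z. norm z ^ e < 4 * \<rho> \<Longrightarrow> (f has_field_derivative P (z ^ e / 4)) (at z)"
    and ev: "\<forall>\<^sub>F x in at_right (0::real). \<phi> (of_real x) = f (of_real x)"
  obtains r where "0 < r" "r ^ e < 4 * \<rho>" "convexity_radius \<beta> (normalized_germ \<phi>) = ereal r"
    "1 - e * real_eval A (r ^ e / 4) = \<beta>"
    "\<And>s. 0 < s \<Longrightarrow> s < r \<Longrightarrow> 1 - e * real_eval A (s ^ e / 4) \<noteq> \<beta>"
proof -
  \<comment> \<open>the radius at which \<open>z ^ e / 4\<close> reaches modulus \<open>\<rho>\<close>\<close>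
  define R where "R = root e (4 * \<rho>)"
  have R: "0 < R" "R ^ e = 4 * \<rho>" using e \<rho> by (simp_all add: R_def)
  have less_R: "x ^ e < 4 * \<rho> \<longleftrightarrow> x < R" if "0 \<le> x" for x
    using power_less_imp_less_base[of x e R] power_strict_mono[of x R e] that R e by auto
  define \<tau> where "\<tau> x = e * real_eval A (x ^ e / 4)" for x
  have rad: "ereal (x ^ e / 4) < fps_conv_radius A" if "0 \<le> x" "x < R" for x
  proof -
    have "x ^ e < 4 * \<rho>" using less_R that by blast
    then have "x ^ e / 4 < \<rho>" by simp
    then show ?thesis using A(3) less_le_trans[of "ereal (x ^ e / 4)" "ereal \<rho>"] by simp
  qed
  have mono: "\<tau> x \<le> \<tau> y" if "0 \<le> x" "x \<le> y" "y < R" for x y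
    unfolding \<tau>_def using that A e
    by (intro mult_left_mono real_eval_mono rad divide_right_mono power_mono) auto
  obtain y where y: "0 \<le> y" "y < \<rho>" "(1 - \<beta>) / e < real_eval A y"
    using unb[of "(1 - \<beta>) / e"] by auto
  define r1 where "r1 = root e (4 * y)"
  have r1: "0 \<le> r1" "r1 ^ e = 4 * y" using e y by (simp_all add: r1_def)
  have "r1 < R" using less_R[OF r1(1)] y r1 by simp
  have "1 - \<beta> < \<tau> r1" using y e by (simp add: \<tau>_def r1 field_simps)
  have cont: "continuous_on {0..r1} \<tau>"
  proof -
    have "continuous_on {0..r1} (\<lambda>x. real_eval A (x ^ e / 4))"
      by (rule continuous_on_compose2[of "{0..r1 ^ e / 4}" "real_eval A"])
        (auto intro!: continuous_on_real_eval continuous_intros divide_right_mono power_mono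
          intro: le_less_trans[OF _ rad[OF r1(1) \<open>r1 < R\<close>]])
    then show ?thesis unfolding \<tau>_def by (intro continuous_intros)
  qed
  have "\<tau> 0 = 0" using A by (simp add: \<tau>_def real_eval_def zero_power[OF e] eval_fps_at_0)
  \<comment> \<open>\<open>\<tau>\<close> is only known to be weakly increasing, so \<open>r\<close> is taken to be the least solution\<close>
  define Z where "Z = {x\<in>{0..r1}. \<tau> x = 1 - \<beta>}"
  have "\<exists>x\<ge>0. x \<le> r1 \<and> \<tau> x = 1 - \<beta>"
    by (rule IVT') (use \<open>\<tau> 0 = 0\<close> \<beta> \<open>1 - \<beta> < \<tau> r1\<close> r1(1) cont in simp_all)
  then have "Z \<noteq> {}" by (auto simp: Z_def)
  moreover have "compact Z"
  proof -
    have "closed Z" unfolding Z_def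
      by (rule continuous_closed_preimage_constant[OF cont]) auto
    moreover have "bounded Z" unfolding Z_def by (rule bounded_subset[of "{0..r1}"]) auto
    ultimately show ?thesis by (simp add: compact_eq_bounded_closed)
  qed
  ultimately obtain r where r: "r \<in> Z" "\<And>x. x \<in> Z \<Longrightarrow> r \<le> x"
    using compact_attains_inf[of Z] by blast
  have r2: "0 \<le> r" "r < R" "\<tau> r = 1 - \<beta>" using r(1) \<open>r1 < R\<close> by (auto simp: Z_def)
  then have r0: "0 < r" using \<open>\<tau> 0 = 0\<close> \<beta> by (cases "r = 0") auto
  have less: "\<tau> s < 1 - \<beta>" if "0 \<le> s" "s < r" for s
  proof -
    have "\<tau> s \<noteq> 1 - \<beta>" using r that by (force simp: Z_def)
    then show ?thesis using mono[of s r] that r2 by simp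
  qed

  define F where "F = fps_expansion f 0"
  define g where "g = eval_fps F"
  have fd: "(f has_field_derivative P (z ^ e / 4)) (at z)" if "norm z < R" for z
    using f' less_R that by simp
  have hol: "f holomorphic_on ball 0 R"
    using holomorphic_on_open[of "ball 0 R" f] fd by fastforce
  have hol': "f holomorphic_on eball 0 (ereal R)" using hol by simp
  have germ: "normalized_germ \<phi> = F"
    unfolding F_def using normalized_germ_eq[OF R(1) hol f0 _ ev] fd[of 0] R e P0
    by (simp add: DERIV_imp_deriv power_0_left)
  have rF: "ereal R \<le> fps_conv_radius F"
    unfolding F_def by (rule conv_radius_fps_expansion[OF hol'])
  have gf: "g z = f z" if "norm z < R" for z
    using eval_fps_expansion'[OF hol', of z] that by (simp add: F_def g_def)
  have wR: "norm (z ^ e / 4) < \<rho>" if "norm z < R" for z :: complex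
  proof -
    have "norm z ^ e < 4 * \<rho>" using less_R[of "norm z"] that by simp
    then show ?thesis by (simp add: norm_divide norm_power)
  qed
  have d1: "deriv g z = P (z ^ e / 4)" if "norm z < R" for z
    by (rule DERIV_imp_deriv, rule has_field_derivative_transform_within_open[OF fd, of _ "ball 0 R"])
      (use that gf in auto)
  have d2: "z * deriv (deriv g) z = - (e * eval_fps A (z ^ e / 4)) * P (z ^ e / 4)" if z: "norm z < R" for z
  proof -
    have "((\<lambda>z. P (z ^ e / 4)) has_field_derivative dP (z ^ e / 4) * (e * z ^ (e - 1) / 4)) (at z)"
      by (rule DERIV_chain2[of P]) (auto intro!: P' wR z derivative_eq_intros)
    then have "(deriv g has_field_derivative dP (z ^ e / 4) * (e * z ^ (e - 1) / 4)) (at z)"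
      by (rule has_field_derivative_transform_within_open[of _ _ _ "ball 0 R"]) (use z d1 in auto)
    then have "z * deriv (deriv g) z = z * (dP (z ^ e / 4) * (e * z ^ (e - 1) / 4))"
      by (simp add: DERIV_imp_deriv)
    also have "\<dots> = e * (z * z ^ (e - 1) / 4 * dP (z ^ e / 4))" by simp
    also have "z * z ^ (e - 1) = z ^ e" using e by (simp add: power_eq_if)
    also have "z ^ e / 4 * dP (z ^ e / 4) = - eval_fps A (z ^ e / 4) * P (z ^ e / 4)"
      by (rule PA[OF wR[OF z]])
    finally show ?thesis by simp
  qed
  have quot: "deriv g z \<noteq> 0" "1 + z * deriv (deriv g) z / deriv g z = 1 - e * eval_fps A (z ^ e / 4)"
    if z: "norm z < R" for z
    using d1[OF z] d2[OF z] Pnz[OF wR[OF z]] by simp_all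
  define S where "S = {ereal s | s. 0 < s \<and> ereal s < fps_conv_radius F \<and>
     (\<forall>z. norm z < s \<longrightarrow> deriv g z \<noteq> 0 \<and> Re (1 + z * deriv (deriv g) z / deriv g z) > \<beta>)}"
  have "Sup S = ereal r"
  proof (rule antisym)
    have "Re (1 + z * deriv (deriv g) z / deriv g z) > \<beta>" if z: "norm z < r" for z
    proof -
      have "Re (eval_fps A (z ^ e / 4)) \<le> norm (eval_fps A (z ^ e / 4))" by (rule complex_Re_le_cmod)
      also have "\<dots> \<le> real_eval A (norm (z ^ e / 4))"
        by (rule norm_eval_fps_le_real_eval[OF A(1)])
          (use rad[of "norm z"] z r2 in \<open>simp add: norm_divide norm_power\<close>)
      also have "norm (z ^ e / 4) = norm z ^ e / 4" by (simp add: norm_divide norm_power)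
      finally have "e * Re (eval_fps A (z ^ e / 4)) \<le> \<tau> (norm z)"
        unfolding \<tau>_def by (intro mult_left_mono) auto
      also have "\<dots> < 1 - \<beta>" using z by (intro less) auto
      finally show ?thesis using quot[of z] z r2 by simp
    qed
    moreover have "ereal r < fps_conv_radius F"
      using r2 rF less_le_trans[of "ereal r" "ereal R"] by simp
    ultimately have "ereal r \<in> S" unfolding S_def using r0 quot(1) r2 by auto
    then show "ereal r \<le> Sup S" by (rule Sup_upper)
    show "Sup S \<le> ereal r"
    proof (rule Sup_least, rule ccontr)
      fix x assume "x \<in> S" and "\<not> x \<le> ereal r"
      then obtain s where s: "x = ereal s"
        "\<forall>z. norm z < s \<longrightarrow> deriv g z \<noteq> 0 \<and> Re (1 + z * deriv (deriv g) z / deriv g z) > \<beta>"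
        unfolding S_def by blast
      have "r < s" using \<open>\<not> x \<le> ereal r\<close> s(1) by simp
      then have "Re (1 + of_real r * deriv (deriv g) (of_real r) / deriv g (of_real r)) > \<beta>"
        using r0 s(2) by simp
      then have "1 - e * Re (eval_fps A (of_real r ^ e / 4)) > \<beta>"
        using quot(2)[of "of_real r"] r0 r2 by simp
      then have "1 - \<tau> r > \<beta>" by (simp add: \<tau>_def real_eval_def)
      then show False using r2 by simp
    qed
  qed
  then have "convexity_radius \<beta> (normalized_germ \<phi>) = ereal r"
    unfolding germ convexity_radius_def Let_def g_def[symmetric] S_def .
  moreover have "r ^ e < 4 * \<rho>" using less_R r2 by simp
  moreover have "1 - e * real_eval A (r ^ e / 4) = \<beta>" using r2 by (simp add: \<tau>_def)
  moreover have "1 - e * real_eval A (s ^ e / 4) \<noteq> \<beta>" if "0 < s" "s < r" for s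
    using less[of s] that by (simp add: \<tau>_def)
  ultimately show thesis using that r0 by blast
qed

section \<open>The three root equations\<close>

lemma least_zero_at_first_zero:
  assumes G: "rayleigh_positive G"
    and N: "\<And>x. 0 < x \<Longrightarrow> N (of_real x) = 0 \<longleftrightarrow> eval_fps G (of_real (x\<^sup>2 / 4)) = 0"
  shows "is_least_pos (\<lambda>x. N (complex_of_real x) = 0) (2 * sqrt (first_zero G))"
  unfolding is_least_pos_def
proof (intro conjI allI impI)
  let ?l = "2 * sqrt (first_zero G)"
  note pos = first_zero_pos[OF G]
  show "0 < ?l" using pos by simp
  then show "N (of_real ?l) = 0"
    using pos eval_first_zero[OF G] by (subst N) (simp_all add: power_mult_distrib)
  fix s assume s: "0 < s \<and> N (complex_of_real s) = 0"
  then have "eval_fps G (of_real (s\<^sup>2 / 4)) = 0" using N by blast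
  then have "first_zero G \<le> norm (complex_of_real (s\<^sup>2 / 4))"
    using nonzero_below_first_zero[OF G] not_le by blast
  then have "4 * first_zero G \<le> s\<^sup>2" unfolding norm_of_real by simp
  then have "sqrt (4 * first_zero G) \<le> s" using s by (intro real_le_lsqrt) auto
  then show "?l \<le> s" by (simp add: real_sqrt_mult)
qed

lemma is_least_posI:
  assumes r: "0 < r" "r ^ e < b" "0 < e"
    and P: "\<And>s. 0 < s \<Longrightarrow> s ^ e < b \<Longrightarrow> P s \<longleftrightarrow> q s = \<beta>"
    and q: "q r = \<beta>" "\<And>s. 0 < s \<Longrightarrow> s < r \<Longrightarrow> q s \<noteq> \<beta>"
  shows "is_least_pos P (r::real)"
  unfolding is_least_pos_def
proof (intro conjI allI impI)
  show "0 < r" "P r" using r q(1) P by auto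
  fix s assume s: "0 < s \<and> P s"
  show "r \<le> s"
  proof (rule ccontr)
    assume "\<not> r \<le> s"
    then have "s < r" by simp
    moreover have "s ^ e < r ^ e" using \<open>s < r\<close> s r(3) by (intro power_strict_mono) auto
    ultimately show False using s r q(2)[of s] P[of s] by auto
  qed
qed

lemma one_minus_of_real_eq_iff: "(1::complex) + - of_real x = of_real y \<longleftrightarrow> 1 - x = y"
proof -
  have "(1::complex) + - of_real x = of_real (1 - x)" by simp
  then show ?thesis by (simp only: of_real_eq_iff)
qed

text \<open>Write \<open>E = euler_op \<nu>\<close> and \<open>p = 2 / s\<close>. The two identities are
  \<open>(E - \<nu>) (E - \<nu> + p) M = p * 2 X D'\<close> and \<open>(E - \<nu> + p) M = p D\<close>, since \<open>E - \<nu> = 2 X d/dX\<close>. The numerators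
  and denominators in the root equations for \<open>f\<close>, \<open>g\<close> and \<open>h\<close> have this form with \<open>p = \<nu>\<close>, \<open>p = 1\<close>
  and \<open>p = 2\<close>.\<close>

lemma euler_op_theta_step:
  fixes \<nu> :: real
  assumes D: "D = theta_step s 0 M" and s: "s \<noteq> 0"
  shows "euler_op \<nu> (euler_op \<nu> M) - euler_op \<nu> M + fps_const (of_real (1 + 2 / s - 2 * \<nu>)) * euler_op \<nu> M
      + fps_const (of_real (\<nu>\<^sup>2 - 2 * \<nu> / s)) * M = fps_const (of_real (4 / s)) * fps_X * fps_deriv D"
    and "euler_op \<nu> M + fps_const (of_real (2 / s - \<nu>)) * M = fps_const (of_real (2 / s)) * D"
proof -
  define k v S where "k = fps_const (complex_of_real (2 / s))" and "v = fps_const (complex_of_real \<nu>)"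
    and "S = fps_const (complex_of_real s)"
  have kS: "k * S = 2" using s by (simp add: k_def S_def fps_numeral_fps_const)
  have c: "fps_const (complex_of_real (1 + 2 / s - 2 * \<nu>)) = 1 + k - 2 * v"
    "fps_const (complex_of_real (\<nu>\<^sup>2 - 2 * \<nu> / s)) = v * v - k * v"
    "fps_const (complex_of_real (4 / s)) = 2 * k"
    "fps_const (complex_of_real (2 / s - \<nu>)) = k - v"
    by (simp_all add: k_def v_def fps_numeral_fps_const power2_eq_square mult.commute flip: fps_const_1_eq_1)
  have D': "k * D = k * M + (k * S) * (fps_X * fps_deriv M)"
    unfolding D theta_step_def by (simp add: S_def algebra_simps)
  then have kD: "k * D = k * M + 2 * fps_X * fps_deriv M" by (simp add: kS)
  show "euler_op \<nu> M + fps_const (of_real (2 / s - \<nu>)) * M = fps_const (of_real (2 / s)) * D"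
    unfolding c k_def[symmetric] kD by (simp add: euler_op_def v_def[symmetric] algebra_simps)
  have "k * fps_deriv D = fps_deriv (k * D)" by (simp add: k_def)
  also have "\<dots> = k * fps_deriv M + 2 * fps_deriv M + 2 * fps_X * fps_deriv (fps_deriv M)"
    unfolding kD by (simp add: k_def algebra_simps)
  finally have kD': "k * fps_deriv D = k * fps_deriv M + 2 * fps_deriv M + 2 * fps_X * fps_deriv (fps_deriv M)" .
  have "2 * k * fps_X * fps_deriv D = 2 * fps_X * (k * fps_deriv D)" by (simp add: mult_ac)
  then show "euler_op \<nu> (euler_op \<nu> M) - euler_op \<nu> M + fps_const (of_real (1 + 2 / s - 2 * \<nu>)) * euler_op \<nu> M
      + fps_const (of_real (\<nu>\<^sup>2 - 2 * \<nu> / s)) * M = fps_const (of_real (4 / s)) * fps_X * fps_deriv D"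
    unfolding c kD' by (simp add: euler_op_def v_def[symmetric] algebra_simps) (simp add: v_def algebra_simps)
qed

text \<open>From here on, \<open>N\<close> stands for \<open>N\<^sub>\<nu>\<close>, \<open>k\<close> for its normalising constant and \<open>M\<close> for its normalised series.\<close>

context
  fixes N :: "complex \<Rightarrow> complex" and k :: complex and \<nu> \<beta> :: real and M :: "complex fps"
  assumes M: "rayleigh_positive M" and k: "k \<noteq> 0"
    and N: "\<And>z. 0 < Re z \<Longrightarrow> N z = inverse k * frobenius \<nu> M z"
    and \<beta>: "\<beta> < 1"
begin

lemmas M_entire = rayleigh_positive_entire[OF M]
  and M_nth_0 = rayleigh_positive_nth_0[OF M]
  and M_nonneg = rayleigh_positive_nonneg[OF M]

lemma N_real:
  assumes "0 < x"
  shows "N (of_real x) = inverse k * frobenius \<nu> M (of_real x)"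
    "of_real x * deriv N (of_real x) = inverse k * frobenius \<nu> (euler_op \<nu> M) (of_real x)"
    "(of_real x)\<^sup>2 * deriv (deriv N) (of_real x)
      = inverse k * frobenius \<nu> (euler_op \<nu> (euler_op \<nu> M) - euler_op \<nu> M) (of_real x)"
proof -
  have x: "0 < Re (complex_of_real x)" using assms by simp
  show "N (of_real x) = inverse k * frobenius \<nu> M (of_real x)" by (rule N[OF x])
  show "of_real x * deriv N (of_real x) = inverse k * frobenius \<nu> (euler_op \<nu> M) (of_real x)"
    "(of_real x)\<^sup>2 * deriv (deriv N) (of_real x)
      = inverse k * frobenius \<nu> (euler_op \<nu> (euler_op \<nu> M) - euler_op \<nu> M) (of_real x)"
    by (rule deriv_right_half_plane[OF M_entire _ x], rule N, assumption)+
qed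

lemma linear_combination_at_real:
  assumes x: "0 < x" and s: "s \<noteq> 0" and D: "D = theta_step s 0 M"
  shows "of_real x * deriv N (of_real x) + of_real (2 / s - \<nu>) * N (of_real x)
     = inverse k * of_real (2 / s) * frobenius \<nu> D (of_real x)"
   and "(of_real x)\<^sup>2 * deriv (deriv N) (of_real x) + of_real (1 + 2 / s - 2 * \<nu>) * (of_real x * deriv N (of_real x))
     + of_real (\<nu>\<^sup>2 - 2 * \<nu> / s) * N (of_real x)
     = inverse k * of_real (4 / s) * frobenius \<nu> (fps_X * fps_deriv D) (of_real x)"
proof -
  have Den: "fps_conv_radius D = \<infinity>" unfolding D by (rule fps_conv_radius_theta_step[OF M_entire])
  note en = entire_intros entire_euler_op M_entire Den
  have "frobenius \<nu> (euler_op \<nu> M + fps_const (of_real (2 / s - \<nu>)) * M) (of_real x)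
    = frobenius \<nu> (fps_const (of_real (2 / s)) * D) (of_real x)"
    by (simp only: euler_op_theta_step(2)[OF D s])
  then have "frobenius \<nu> (euler_op \<nu> M) (of_real x) + of_real (2 / s - \<nu>) * frobenius \<nu> M (of_real x)
    = of_real (2 / s) * frobenius \<nu> D (of_real x)"
    by (simp only: frobenius_add frobenius_cmult en)
  then have "inverse k * (frobenius \<nu> (euler_op \<nu> M) (of_real x) + of_real (2 / s - \<nu>) * frobenius \<nu> M (of_real x))
    = inverse k * (of_real (2 / s) * frobenius \<nu> D (of_real x))"
    by (rule arg_cong)
  then show "of_real x * deriv N (of_real x) + of_real (2 / s - \<nu>) * N (of_real x)
     = inverse k * of_real (2 / s) * frobenius \<nu> D (of_real x)"
    unfolding N_real[OF x] by (simp only: ring_distribs mult_ac)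
  have "frobenius \<nu> (euler_op \<nu> (euler_op \<nu> M) - euler_op \<nu> M + fps_const (of_real (1 + 2 / s - 2 * \<nu>)) * euler_op \<nu> M
    + fps_const (of_real (\<nu>\<^sup>2 - 2 * \<nu> / s)) * M) (of_real x)
    = frobenius \<nu> (fps_const (of_real (4 / s)) * (fps_X * fps_deriv D)) (of_real x)"
    by (simp only: euler_op_theta_step(1)[OF D s] mult.assoc)
  then have "frobenius \<nu> (euler_op \<nu> (euler_op \<nu> M) - euler_op \<nu> M) (of_real x)
      + of_real (1 + 2 / s - 2 * \<nu>) * frobenius \<nu> (euler_op \<nu> M) (of_real x)
      + of_real (\<nu>\<^sup>2 - 2 * \<nu> / s) * frobenius \<nu> M (of_real x)
    = of_real (4 / s) * frobenius \<nu> (fps_X * fps_deriv D) (of_real x)"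
    by (simp only: frobenius_add frobenius_cmult en)
  then have "inverse k * (frobenius \<nu> (euler_op \<nu> (euler_op \<nu> M) - euler_op \<nu> M) (of_real x)
      + of_real (1 + 2 / s - 2 * \<nu>) * frobenius \<nu> (euler_op \<nu> M) (of_real x)
      + of_real (\<nu>\<^sup>2 - 2 * \<nu> / s) * frobenius \<nu> M (of_real x))
    = inverse k * (of_real (4 / s) * frobenius \<nu> (fps_X * fps_deriv D) (of_real x))"
    by (rule arg_cong)
  then show "(of_real x)\<^sup>2 * deriv (deriv N) (of_real x) + of_real (1 + 2 / s - 2 * \<nu>) * (of_real x * deriv N (of_real x))
     + of_real (\<nu>\<^sup>2 - 2 * \<nu> / s) * N (of_real x)
     = inverse k * of_real (4 / s) * frobenius \<nu> (fps_X * fps_deriv D) (of_real x)"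
    unfolding N_real[OF x] by (simp only: ring_distribs mult_ac)
qed

text \<open>The quotient that occurs in the three equations is, up to a factor, the logarithmic derivative of
  \<open>D\<close>: by the identities above it equals \<open>2 X D' / D\<close>.\<close>

lemma quotient_at_real:
  assumes x: "0 < x" and s: "0 < s" and D: "D = theta_step s 0 M" and xs: "x\<^sup>2 < 4 * first_zero D"
  defines "d \<equiv> of_real x * deriv N (of_real x) + of_real (2 / s - \<nu>) * N (of_real x)"
    and "n \<equiv> (of_real x)\<^sup>2 * deriv (deriv N) (of_real x) + of_real (1 + 2 / s - 2 * \<nu>) * (of_real x * deriv N (of_real x))
     + of_real (\<nu>\<^sup>2 - 2 * \<nu> / s) * N (of_real x)"
  shows "d \<noteq> 0" and "n / d = - of_real (2 * real_eval (fps_X * neg_log_deriv D) (x\<^sup>2 / 4))"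
proof -
  have DR: "rayleigh_positive D" unfolding D by (rule theta_step_rayleigh_positive(1)[OF M s]) simp
  define w where "w = x\<^sup>2 / 4"
  have w: "0 < w" "w < first_zero D" using x xs by (simp_all add: w_def)
  note De = rayleigh_positive_entire[OF DR] rayleigh_positive_nth_0[OF DR] rayleigh_positive_nonneg[OF DR]
  have r: "ereal w < fps_conv_radius (neg_log_deriv D)" using w by (simp add: radius_eq_first_zero[OF DR])
  have nz: "eval_fps D (of_real w) \<noteq> 0"
    using nonzero_below_first_zero[OF DR, of "of_real w"] w by simp
  have fd: "frobenius \<nu> D (of_real x) = of_real x powr of_real \<nu> * eval_fps D (of_real w)"
    "frobenius \<nu> (fps_X * fps_deriv D) (of_real x)
       = of_real x powr of_real \<nu> * (of_real w * eval_fps (fps_deriv D) (of_real w))"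
    using De by (simp_all add: frobenius_def w_def eval_fps_mult entire_intros)
  have dd: "eval_fps (fps_deriv D) (of_real w) = - of_real (real_eval (neg_log_deriv D) w) * eval_fps D (of_real w)"
    using eval_fps_deriv_neg_log_deriv[OF De(2,1), of "of_real w"] r w eval_fps_of_real[OF De(3) _ r] by simp
  have re: "real_eval (fps_X * neg_log_deriv D) w = w * real_eval (neg_log_deriv D) w"
    unfolding real_eval_def using r w by (subst eval_fps_mult) (auto)
  have d: "d = inverse k * of_real (2 / s) * (of_real x powr of_real \<nu> * eval_fps D (of_real w))"
    unfolding d_def using linear_combination_at_real(1)[OF x _ D] s fd by simp
  then show "d \<noteq> 0" using k s x nz by simp
  have "n = inverse k * of_real (4 / s) * (of_real x powr of_real \<nu> * (of_real w * eval_fps (fps_deriv D) (of_real w)))"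
    unfolding n_def using linear_combination_at_real(2)[OF x _ D] s fd by simp
  also have "\<dots> = - of_real (2 * (w * real_eval (neg_log_deriv D) w)) * d"
    unfolding d dd by simp
  finally show "n / d = - of_real (2 * real_eval (fps_X * neg_log_deriv D) (x\<^sup>2 / 4))"
    using \<open>d \<noteq> 0\<close> unfolding w_def[symmetric] re by simp
qed

text \<open>For \<open>f (z) = z M (z ^ e / 4)\<close> the derivative is \<open>f' (z) = D (z ^ e / 4)\<close>. The function \<open>g\<^sub>\<nu>\<close> is the
  case \<open>e = 2\<close>, and \<open>h\<^sub>\<nu>\<close> is the case \<open>e = 1\<close>.\<close>

lemma convexity_radius_monomial_times_M:
  assumes e: "0 < e" and D: "D = theta_step (real e) 0 M"
    and ev: "\<forall>\<^sub>F x in at_right (0::real). \<phi> (of_real x) = of_real x * eval_fps M (of_real x ^ e / 4)"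
  obtains r where "0 < r" "r ^ e < 4 * first_zero D"
    "convexity_radius \<beta> (normalized_germ \<phi>) = ereal r"
    "1 - e * real_eval (fps_X * neg_log_deriv D) (r ^ e / 4) = \<beta>"
    "\<And>s. 0 < s \<Longrightarrow> s < r \<Longrightarrow> 1 - e * real_eval (fps_X * neg_log_deriv D) (s ^ e / 4) \<noteq> \<beta>"
proof -
  note outer = that
  have DR: "rayleigh_positive D" unfolding D by (rule theta_step_rayleigh_positive(1)[OF M]) (use e in auto)
  note De = rayleigh_positive_entire[OF DR] rayleigh_positive_nth_0[OF DR] rayleigh_positive_nonneg[OF DR]
  have rad: "ereal (first_zero D) \<le> fps_conv_radius (fps_X * neg_log_deriv D)"
    using fps_conv_radius_mult[of fps_X "neg_log_deriv D"] by (simp add: radius_eq_first_zero[OF DR])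
  have ev_mult: "eval_fps (fps_X * neg_log_deriv D) w = w * eval_fps (neg_log_deriv D) w" if "norm w < first_zero D" for w
    using that by (subst eval_fps_mult) (simp_all add: radius_eq_first_zero[OF DR])
  show thesis
  proof (rule convexity_radius_eq_first_root[where e = e and \<beta> = \<beta> and \<rho> = "first_zero D" and
        A = "fps_X * neg_log_deriv D" and P = "eval_fps D" and dP = "eval_fps (fps_deriv D)" and
        f = "\<lambda>z. z * eval_fps M (z ^ e / 4)" and \<phi> = \<phi>])
    show "nonneg_coeffs (fps_X * neg_log_deriv D)"
      by (rule nonneg_coeffs_mult[OF nonneg_coeffs_X De(3)])
    show "\<exists>x\<in>{0..<first_zero D}. K < real_eval (fps_X * neg_log_deriv D) x" for K
      using times_neg_log_deriv_unbounded[OF DR, of K] ev_mult by (force simp: real_eval_def)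
    show "(eval_fps D has_field_derivative eval_fps (fps_deriv D) w) (at w)" for w
      by (rule has_field_derivative_eval_fps) (simp add: De)
    show "w * eval_fps (fps_deriv D) w = - eval_fps (fps_X * neg_log_deriv D) w * eval_fps D w"
      if "norm w < first_zero D" for w
      using eval_fps_deriv_neg_log_deriv[OF De(2,1), of w] ev_mult[OF that] that
      by (simp add: radius_eq_first_zero[OF DR])
    show "((\<lambda>z. z * eval_fps M (z ^ e / 4)) has_field_derivative eval_fps D (z ^ e / 4)) (at z)" for z
    proof -
      have "((\<lambda>z. eval_fps M (z ^ e / 4)) has_field_derivative
          eval_fps (fps_deriv M) (z ^ e / 4) * (e * z ^ (e - 1) / 4)) (at z)"
        by (rule DERIV_chain2[of "eval_fps M"])
          (auto intro!: has_field_derivative_eval_fps derivative_eq_intros simp: M_entire)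
      from DERIV_mult[OF DERIV_ident this]
      have "((\<lambda>z. z * eval_fps M (z ^ e / 4)) has_field_derivative
          eval_fps M (z ^ e / 4) + e * (z * z ^ (e - 1) / 4 * eval_fps (fps_deriv M) (z ^ e / 4))) (at z)"
        by (simp add: algebra_simps)
      also have "z * z ^ (e - 1) = z ^ e" using e by (simp add: power_eq_if)
      finally show ?thesis by (simp add: D eval_fps_theta_step[OF M_entire] mult.assoc)
    qed
    show thesis if "0 < r" "r ^ e < 4 * first_zero D"
      "convexity_radius \<beta> (normalized_germ \<phi>) = ereal r"
      "1 - e * real_eval (fps_X * neg_log_deriv D) (r ^ e / 4) = \<beta>"
      "\<And>s. 0 < s \<Longrightarrow> s < r \<Longrightarrow> 1 - e * real_eval (fps_X * neg_log_deriv D) (s ^ e / 4) \<noteq> \<beta>" for r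
      by (rule outer) (use that in auto)
  qed (use e \<beta> first_zero_pos[OF DR] De nonzero_below_first_zero[OF DR] rad ev in \<open>auto simp: eval_fps_at_0\<close>)
qed

lemma convexity_radius_g:
  "\<exists>r. is_least_pos (g_root N \<nu> \<beta>) r \<and>
    convexity_radius \<beta> (normalized_germ (\<lambda>z. k * z powr of_real (1 - \<nu>) * N z)) = ereal r"
proof -
  define D where "D = theta_step (real 2) 0 M"
  have D2: "D = theta_step 2 0 M" by (simp add: D_def)
  have root: "g_root N \<nu> \<beta> s \<longleftrightarrow> 1 - real 2 * real_eval (fps_X * neg_log_deriv D) (s ^ 2 / 4) = \<beta>"
    if s: "0 < s" "s ^ 2 < 4 * first_zero D" for s
  proof -
    note q = quotient_at_real[OF s(1) _ D2 s(2)]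
    have eq: "of_real s * deriv N (of_real s) + (1 - of_real \<nu>) * N (of_real s)
        = of_real s * deriv N (of_real s) + of_real (2 / 2 - \<nu>) * N (of_real s)"
      "(of_real s)\<^sup>2 * deriv (deriv N) (of_real s) + (2 - 2 * of_real \<nu>) * of_real s * deriv N (of_real s)
         + ((of_real \<nu>)\<^sup>2 - of_real \<nu>) * N (of_real s)
        = (of_real s)\<^sup>2 * deriv (deriv N) (of_real s) + of_real (1 + 2 / 2 - 2 * \<nu>) * (of_real s * deriv N (of_real s))
         + of_real (\<nu>\<^sup>2 - 2 * \<nu> / 2) * N (of_real s)"
      by simp_all
    show ?thesis
      unfolding g_root_def Let_def eq q(2)[OF zero_less_numeral] one_minus_of_real_eq_iff
      using q(1)[OF zero_less_numeral] by simp
  qed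
  have ev: "\<forall>\<^sub>F x in at_right (0::real). k * of_real x powr of_real (1 - \<nu>) * N (of_real x)
      = of_real x * eval_fps M (of_real x ^ 2 / 4)"
    using eventually_at_right_less[of 0]
  proof eventually_elim
    case (elim x)
    have "complex_of_real x powr of_real (1 - \<nu>) * of_real x powr of_real \<nu> = of_real (x powr (1 - \<nu>) * x powr \<nu>)"
      using elim by (simp add: powr_of_real flip: of_real_diff)
    also have "x powr (1 - \<nu>) * x powr \<nu> = x" using elim by (simp flip: powr_add)
    finally have p: "complex_of_real x powr of_real (1 - \<nu>) * of_real x powr of_real \<nu> = of_real x" .
    have "k * of_real x powr of_real (1 - \<nu>) * N (of_real x)
      = (of_real x powr of_real (1 - \<nu>) * of_real x powr of_real \<nu>) * eval_fps M (of_real x ^ 2 / 4)"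
      using N[of "of_real x"] elim k by (simp add: frobenius_def)
    then show ?case unfolding p .
  qed
  obtain r where r: "0 < r" "r ^ 2 < 4 * first_zero D"
    "convexity_radius \<beta> (normalized_germ (\<lambda>z. k * z powr of_real (1 - \<nu>) * N z)) = ereal r"
    "1 - real 2 * real_eval (fps_X * neg_log_deriv D) (r ^ 2 / 4) = \<beta>"
    "\<And>s. 0 < s \<Longrightarrow> s < r \<Longrightarrow> 1 - real 2 * real_eval (fps_X * neg_log_deriv D) (s ^ 2 / 4) \<noteq> \<beta>"
    using convexity_radius_monomial_times_M[OF pos2 D_def ev] by blast
  have "is_least_pos (g_root N \<nu> \<beta>) r"
    by (rule is_least_posI[where e = 2 and \<beta> = \<beta> and
          q = "\<lambda>s. 1 - real 2 * real_eval (fps_X * neg_log_deriv D) (s ^ 2 / 4)", OF r(1,2) pos2 root r(4,5)])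
  with r(3) show ?thesis by blast
qed

lemma convexity_radius_h:
  "\<exists>r. is_least_pos (h_root N \<nu> \<beta>) r \<and>
    convexity_radius \<beta> (normalized_germ (\<lambda>z. k * z powr of_real (1 - \<nu> / 2) * N (csqrt z))) = ereal r"
proof -
  define D where "D = theta_step (real 1) 0 M"
  have D1: "D = theta_step 1 0 M" by (simp add: D_def)
  have root: "h_root N \<nu> \<beta> r \<longleftrightarrow> 1 - real 1 * real_eval (fps_X * neg_log_deriv D) (r ^ 1 / 4) = \<beta>"
    if r: "0 < r" "r ^ 1 < 4 * first_zero D" for r
  proof -
    define s where "s = sqrt r"
    have s: "0 < s" "s\<^sup>2 < 4 * first_zero D" "s\<^sup>2 = r" using r by (simp_all add: s_def)
    define d n where "d = of_real s * deriv N (of_real s) + of_real (2 / 1 - \<nu>) * N (of_real s)"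
      and "n = (of_real s)\<^sup>2 * deriv (deriv N) (of_real s) + of_real (1 + 2 / 1 - 2 * \<nu>) * (of_real s * deriv N (of_real s))
         + of_real (\<nu>\<^sup>2 - 2 * \<nu> / 1) * N (of_real s)"
    note q = quotient_at_real[OF s(1) zero_less_one D1 s(2), folded d_def n_def]
    have zr: "complex_of_real r = (of_real s)\<^sup>2" using s(3) by (simp flip: of_real_power)
    have d: "2 * of_real s * deriv N (of_real s) + 2 * (2 - of_real \<nu>) * N (of_real s) = 2 * d"
      by (simp add: d_def algebra_simps)
    have n: "of_real r * deriv (deriv N) (of_real s) + (3 - 2 * of_real \<nu>) * of_real s * deriv N (of_real s)
         + ((of_real \<nu>)\<^sup>2 - 2 * of_real \<nu>) * N (of_real s) = n"
      by (simp add: n_def zr)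
    have v: "n / (2 * d) = - of_real (real_eval (fps_X * neg_log_deriv D) (r / 4))"
    proof -
      have "n / (2 * d) = (n / d) / 2" by simp
      then show ?thesis unfolding q(2) s(3) by simp
    qed
    show ?thesis
      unfolding h_root_def Let_def s_def[symmetric] d n v one_minus_of_real_eq_iff
      using q(1) by simp
  qed
  have ev: "\<forall>\<^sub>F x in at_right (0::real). k * of_real x powr of_real (1 - \<nu> / 2) * N (csqrt (of_real x))
      = of_real x * eval_fps M (of_real x ^ 1 / 4)"
    using eventually_at_right_less[of 0]
  proof eventually_elim
    case (elim x)
    have "complex_of_real x powr of_real (1 - \<nu> / 2) * of_real (sqrt x) powr of_real \<nu>
      = of_real (x powr (1 - \<nu> / 2)) * of_real (sqrt x powr \<nu>)"
      using elim by (subst (1 2) powr_of_real) simp_all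
    also have "\<dots> = of_real (x powr (1 - \<nu> / 2) * sqrt x powr \<nu>)" by simp
    also have "x powr (1 - \<nu> / 2) * sqrt x powr \<nu> = x"
      using elim by (simp add: powr_half_sqrt[symmetric] powr_powr flip: powr_add)
    finally have p: "complex_of_real x powr of_real (1 - \<nu> / 2) * of_real (sqrt x) powr of_real \<nu> = of_real x" .
    have c: "csqrt (of_real x) = of_real (sqrt x)" by (rule of_real_sqrt[symmetric]) (use elim in simp)
    have sq: "(complex_of_real (sqrt x))\<^sup>2 = of_real x" using elim by (simp flip: of_real_power)
    have "k * of_real x powr of_real (1 - \<nu> / 2) * N (csqrt (of_real x))
      = (of_real x powr of_real (1 - \<nu> / 2) * of_real (sqrt x) powr of_real \<nu>) * eval_fps M (of_real x / 4)"
      unfolding c using N[of "of_real (sqrt x)"] elim k by (simp add: frobenius_def sq)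
    then show ?case unfolding p by simp
  qed
  obtain r where r: "0 < r" "r ^ 1 < 4 * first_zero D"
    "convexity_radius \<beta> (normalized_germ (\<lambda>z. k * z powr of_real (1 - \<nu> / 2) * N (csqrt z))) = ereal r"
    "1 - real 1 * real_eval (fps_X * neg_log_deriv D) (r ^ 1 / 4) = \<beta>"
    "\<And>s. 0 < s \<Longrightarrow> s < r \<Longrightarrow> 1 - real 1 * real_eval (fps_X * neg_log_deriv D) (s ^ 1 / 4) \<noteq> \<beta>"
    using convexity_radius_monomial_times_M[OF zero_less_one D_def ev] by blast
  have "is_least_pos (h_root N \<nu> \<beta>) r"
    by (rule is_least_posI[where e = 1 and \<beta> = \<beta> and
          q = "\<lambda>s. 1 - real 1 * real_eval (fps_X * neg_log_deriv D) (s ^ 1 / 4)", OF r(1,2) zero_less_one root r(4,5)])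
  with r(3) show ?thesis by blast
qed

text \<open>Here \<open>f (z) = z M (z\<^sup>2 / 4) powr (1 / \<nu>)\<close>, hence \<open>f' = M powr \<kappa> * D\<close> in the variable \<open>z\<^sup>2 / 4\<close>, with
  \<open>\<kappa> = 1 / \<nu> - 1\<close>, and \<open>A\<close> is \<open>X\<close> times \<open>- D' / D - \<kappa> M' / M\<close>. For \<open>\<nu> > 1\<close> the number \<open>\<kappa>\<close> is negative, and
  the coefficients of \<open>A\<close> are nonnegative because those of \<open>v = - D' / D + M' / M\<close> are:
  \<open>A = X (v + u / \<nu>)\<close> with \<open>u = - M' / M\<close>. The powers of \<open>M\<close> are defined by the primitive \<open>W\<close> of \<open>u\<close>,
  as \<open>M = exp (- W)\<close>. The zeros of \<open>N\<close> and \<open>N'\<close> on the positive axis are those of \<open>M\<close> and \<open>D\<close>.\<close>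

lemma convexity_radius_f:
  assumes \<nu>: "0 < \<nu>"
  obtains r l' l where "is_least_pos (f_root N \<nu> \<beta>) r"
    "convexity_radius \<beta> (normalized_germ (\<lambda>z. (k * N z) powr of_real (1 / \<nu>))) = ereal r"
    "is_least_pos (\<lambda>x. N (of_real x) = 0) l" "is_least_pos (\<lambda>x. deriv N (of_real x) = 0) l'"
    "r < l'" "l' < l"
proof -
  define s where "s = 2 / \<nu>"
  define D where "D = theta_step s 0 M"
  define \<kappa> where "\<kappa> = 1 / \<nu> - 1"
  have s: "0 < s" "2 / s = \<nu>" "1 + 2 / s - 2 * \<nu> = 1 - \<nu>" "\<nu>\<^sup>2 - 2 * \<nu> / s = 0"
    using \<nu> by (simp_all add: s_def power2_eq_square)
  have DR: "rayleigh_positive D" and lt: "first_zero D < first_zero M"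
    unfolding D_def using theta_step_rayleigh_positive[OF M s(1)] by simp_all
  define \<rho> where "\<rho> = first_zero D"
  have \<rho>: "0 < \<rho>" "\<rho> < first_zero M" using first_zero_pos[OF DR] lt by (simp_all add: \<rho>_def)
  note De = rayleigh_positive_entire[OF DR] rayleigh_positive_nth_0[OF DR] rayleigh_positive_nonneg[OF DR]
  define u where "u = neg_log_deriv M"
  define v where "v = neg_log_deriv D - u"
  define W where "W = fps_integral0 u"
  define A where "A = fps_X * (v + fps_const (of_real (1 / \<nu>)) * u)"
  have u: "nonneg_coeffs u" "ereal \<rho> \<le> fps_conv_radius u"
    using M_nonneg \<rho> by (simp_all add: u_def radius_eq_first_zero[OF M])
  have D': "nonneg_coeffs (neg_log_deriv D)" "fps_conv_radius (neg_log_deriv D) = ereal \<rho>"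
    using De(3) by (simp_all add: \<rho>_def radius_eq_first_zero[OF DR])
  have v: "nonneg_coeffs v" "ereal \<rho> \<le> fps_conv_radius v"
  proof -
    show "nonneg_coeffs v"
      unfolding v_def u_def D_def by (rule neg_log_deriv_theta_step[OF M_nth_0 M_nonneg]) (use s in simp_all)
    have "ereal \<rho> \<le> min (fps_conv_radius (neg_log_deriv D)) (fps_conv_radius u)"
      using u D' by simp
    also have "\<dots> \<le> fps_conv_radius v" unfolding v_def by (rule fps_conv_radius_diff)
    finally show "ereal \<rho> \<le> fps_conv_radius v" .
  qed
  have cu: "ereal \<rho> \<le> fps_conv_radius (fps_const (of_real (1 / \<nu>)) * u)"
    using u \<nu> by (simp add: fps_conv_radius_cmult_left)
  have vu: "ereal \<rho> \<le> fps_conv_radius (v + fps_const (of_real (1 / \<nu>)) * u)"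
    using v(2) cu fps_conv_radius_add[of v "fps_const (of_real (1 / \<nu>)) * u"] by (meson min.boundedI order_trans)
  have A: "nonneg_coeffs A" "fps_nth A 0 = 0" "ereal \<rho> \<le> fps_conv_radius A"
  proof -
    show "nonneg_coeffs A"
      unfolding A_def using \<nu>
      by (intro nonneg_coeffs_mult nonneg_coeffs_add nonneg_coeffs_const nonneg_coeffs_X v u) simp
    show "fps_nth A 0 = 0" by (simp add: A_def)
    show "ereal \<rho> \<le> fps_conv_radius A"
      unfolding A_def using vu fps_conv_radius_mult[of fps_X "v + fps_const (of_real (1 / \<nu>)) * u"] by simp
  qed
  have in_rad: "ereal (norm w) < fps_conv_radius B" if "norm w < \<rho>" "ereal \<rho> \<le> fps_conv_radius B"
    for w :: complex and B :: "complex fps"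
    using that less_le_trans[of "ereal (norm w)" "ereal \<rho>"] by simp
  have eval_v: "eval_fps v w = eval_fps (neg_log_deriv D) w - eval_fps u w" if "norm w < \<rho>" for w
    unfolding v_def by (rule eval_fps_diff) (use that in_rad u D' in simp_all)
  have eval_A: "eval_fps A w = w * (eval_fps v w + of_real (1 / \<nu>) * eval_fps u w)" if w: "norm w < \<rho>" for w
    unfolding A_def using in_rad[OF w] u v cu vu
    by (simp add: eval_fps_mult eval_fps_add del: of_real_divide)
  have eval_A': "eval_fps A w = w * (eval_fps (neg_log_deriv D) w + of_real \<kappa> * eval_fps u w)" if w: "norm w < \<rho>" for w
    unfolding eval_A[OF w] eval_v[OF w] \<kappa>_def by (simp add: algebra_simps)
  have real_A: "real_eval A x = x * (real_eval v x + real_eval u x / \<nu>)"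
    and real_v: "real_eval (neg_log_deriv D) x = real_eval v x + real_eval u x"
    and real_uv: "0 \<le> real_eval u x" "0 \<le> real_eval v x" if x: "0 \<le> x" "x < \<rho>" for x
  proof -
    have n: "norm (complex_of_real x) < \<rho>" using x by simp
    have r: "ereal x < fps_conv_radius u" "ereal x < fps_conv_radius v"
      using in_rad[OF n] u v x by simp_all
    show "real_eval A x = x * (real_eval v x + real_eval u x / \<nu>)"
      unfolding real_eval_def eval_A[OF n] by simp
    show "real_eval (neg_log_deriv D) x = real_eval v x + real_eval u x"
      unfolding real_eval_def eval_v[OF n] by simp
    show "0 \<le> real_eval u x" "0 \<le> real_eval v x" using real_eval_nonneg u v r x by blast+
  qed
  have unb: "\<exists>x\<in>{0..<\<rho>}. K < real_eval A x" for K
  proof -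
    \<comment> \<open>\<open>v + u / \<nu> \<ge> m (v + u) = m (- D' / D)\<close>, and the product of the last term with \<open>x\<close> is unbounded\<close>
    define m where "m = min 1 (1 / \<nu>)"
    have m: "0 < m" "m \<le> 1" "m \<le> 1 / \<nu>" using \<nu> by (simp_all add: m_def)
    obtain x where x: "0 \<le> x" "x < \<rho>" "K / m < x * real_eval (neg_log_deriv D) x"
      using times_neg_log_deriv_unbounded[OF DR, of "K / m"] by (auto simp: \<rho>_def)
    have "K < x * (m * real_eval v x + m * real_eval u x)"
      using x m real_v[OF x(1,2)] by (simp add: field_simps)
    also have "\<dots> \<le> x * (1 * real_eval v x + (1 / \<nu>) * real_eval u x)"
      using real_uv[OF x(1,2)] m x by (intro mult_left_mono add_mono mult_right_mono) auto
    also have "\<dots> = real_eval A x" by (simp add: real_A x)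
    finally show ?thesis using x by auto
  qed
  have W: "(eval_fps W has_field_derivative eval_fps u w) (at w)" if "norm w < \<rho>" for w
  proof -
    have "ereal (norm w) < fps_conv_radius W"
      using in_rad[OF that u(2)] fps_conv_radius_integral0[of u] unfolding W_def by (rule less_le_trans)
    then show ?thesis
      using has_field_derivative_eval_fps[of w W UNIV] by (simp add: W_def fps_deriv_fps_integral)
  qed
  have M_exp: "eval_fps M w = exp (- eval_fps W w)" if "norm w < \<rho>" for w
    using eval_eq_exp[OF M, of w] that \<rho> by (simp add: W_def u_def)
  define P where "P w = exp (- of_real \<kappa> * eval_fps W w) * eval_fps D w" for w
  define dP where "dP w = - of_real \<kappa> * eval_fps u w * P w
      + exp (- of_real \<kappa> * eval_fps W w) * eval_fps (fps_deriv D) w" for w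
  define f where "f z = z * exp (- of_real (1 / \<nu>) * eval_fps W (z\<^sup>2 / 4))" for z
  have uD: "eval_fps (fps_deriv D) w = - eval_fps (neg_log_deriv D) w * eval_fps D w" if "norm w < \<rho>" for w
    by (rule eval_fps_deriv_neg_log_deriv[OF De(2,1)]) (use that D' in simp)
  have uM: "eval_fps (fps_deriv M) w = - eval_fps u w * eval_fps M w" if "norm w < \<rho>" for w
    unfolding u_def by (rule eval_fps_deriv_neg_log_deriv[OF M_nth_0 M_entire])
      (use that in_rad u in \<open>simp add: u_def\<close>)
  have ev: "\<forall>\<^sub>F x in at_right (0::real). (k * N (of_real x)) powr of_real (1 / \<nu>) = f (of_real x)"
  proof -
    have "0 < sqrt (4 * \<rho>)" using \<rho> by simp
    then have "\<forall>\<^sub>F x in at_right (0::real). x < sqrt (4 * \<rho>)"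
      unfolding eventually_at_right_field by blast
    then show ?thesis
      using eventually_at_right_less[of 0]
    proof eventually_elim
      case (elim x)
      have "x\<^sup>2 < (sqrt (4 * \<rho>))\<^sup>2" using elim by (intro power_strict_mono) auto
      then have w: "x\<^sup>2 / 4 < \<rho>" using \<rho> by simp
      define y where "y = real_eval W (x\<^sup>2 / 4)"
      have M1: "eval_fps M (of_real x ^ 2 / 4) = of_real (exp (- y))"
        using real_eval_eq_exp[OF M, of "x\<^sup>2 / 4"] w \<rho> by (simp add: y_def W_def u_def)
      have W1: "eval_fps W (of_real x ^ 2 / 4) = of_real y"
      proof -
        have "norm (complex_of_real (x\<^sup>2 / 4)) < \<rho>" using w by (simp only: norm_of_real) simp
        from less_le_trans[OF in_rad[OF this u(2)] fps_conv_radius_integral0]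
        have "ereal (x\<^sup>2 / 4) < fps_conv_radius W" unfolding W_def norm_of_real by simp
        then show ?thesis
          using eval_fps_of_real[of W "x\<^sup>2 / 4"] nonneg_coeffs_integral0[OF u(1)] by (simp add: y_def W_def)
      qed
      have "k * N (of_real x) = of_real x powr of_real \<nu> * of_real (exp (- y))"
        using N[of "of_real x"] elim k M1 by (simp add: frobenius_def)
      also have "\<dots> = of_real (x powr \<nu> * exp (- y))" using elim by (simp add: powr_of_real)
      finally have "(k * N (of_real x)) powr of_real (1 / \<nu>) = of_real ((x powr \<nu> * exp (- y)) powr (1 / \<nu>))"
        by (simp only: powr_of_real mult_nonneg_nonneg powr_ge_zero exp_ge_zero)
      also have "(x powr \<nu> * exp (- y)) powr (1 / \<nu>) = x * exp (- y / \<nu>)"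
        using elim \<nu> by (simp add: powr_mult powr_powr) (simp add: powr_def)
      also have "complex_of_real (x * exp (- y / \<nu>)) = f (of_real x)"
        unfolding f_def W1 by (simp flip: exp_of_real)
      finally show ?case .
    qed
  qed
  obtain r where r: "0 < r" "r ^ 2 < 4 * \<rho>"
    "convexity_radius \<beta> (normalized_germ (\<lambda>z. (k * N z) powr of_real (1 / \<nu>))) = ereal r"
    "1 - real 2 * real_eval A (r ^ 2 / 4) = \<beta>"
    "\<And>s. 0 < s \<Longrightarrow> s < r \<Longrightarrow> 1 - real 2 * real_eval A (s ^ 2 / 4) \<noteq> \<beta>"
  proof (rule convexity_radius_eq_first_root[where e = 2 and \<beta> = \<beta> and \<rho> = \<rho> and A = A and P = P and dP = dP
        and f = f and \<phi> = "\<lambda>z. (k * N z) powr of_real (1 / \<nu>)"])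
    show "P w \<noteq> 0" if "norm w < \<rho>" for w
      using nonzero_below_first_zero[OF DR] that by (simp add: P_def \<rho>_def)
    show "(P has_field_derivative dP w) (at w)" if "norm w < \<rho>" for w
    proof -
      have "(eval_fps D has_field_derivative eval_fps (fps_deriv D) w) (at w)"
        by (rule has_field_derivative_eval_fps) (simp add: De)
      moreover have "((\<lambda>w. exp (- of_real \<kappa> * eval_fps W w)) has_field_derivative
          exp (- of_real \<kappa> * eval_fps W w) * (- of_real \<kappa> * eval_fps u w)) (at w)"
        by (rule DERIV_chain2[OF DERIV_exp DERIV_cmult[OF W[OF that]]])
      ultimately show ?thesis
        unfolding P_def[abs_def] dP_def using DERIV_mult by (fastforce simp: algebra_simps)
    qed
    show "w * dP w = - eval_fps A w * P w" if "norm w < \<rho>" for w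
      unfolding eval_A'[OF that] dP_def uD[OF that] P_def by (simp add: algebra_simps)
    show "(f has_field_derivative P (z ^ 2 / 4)) (at z)" if "norm z ^ 2 < 4 * \<rho>" for z
    proof -
      define w where "w = z\<^sup>2 / 4"
      have w: "norm w < \<rho>" using that by (simp add: w_def norm_divide norm_power)
      have "((\<lambda>z. eval_fps W (z\<^sup>2 / 4)) has_field_derivative eval_fps u w * (z / 2)) (at z)"
        by (rule DERIV_chain2[of "eval_fps W"]) (auto intro!: W derivative_eq_intros w simp: w_def[symmetric])
      then have "(f has_field_derivative z * (exp (- of_real (1 / \<nu>) * eval_fps W w) *
          (- of_real (1 / \<nu>) * (eval_fps u w * (z / 2)))) + 1 * exp (- of_real (1 / \<nu>) * eval_fps W w)) (at z)"
        unfolding f_def w_def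
        by (intro DERIV_mult'[OF DERIV_ident] DERIV_chain2[OF DERIV_exp] DERIV_cmult)
      also have "z * (exp (- of_real (1 / \<nu>) * eval_fps W w) *
          (- of_real (1 / \<nu>) * (eval_fps u w * (z / 2)))) + 1 * exp (- of_real (1 / \<nu>) * eval_fps W w)
          = exp (- of_real (1 / \<nu>) * eval_fps W w) * (1 - of_real s * w * eval_fps u w)"
        by (simp add: w_def s_def power2_eq_square algebra_simps)
      also have "exp (- of_real (1 / \<nu>) * eval_fps W w) = exp (- of_real \<kappa> * eval_fps W w) * eval_fps M w"
        unfolding M_exp[OF w] exp_add[symmetric] by (simp add: \<kappa>_def algebra_simps)
      also have "\<dots> * (1 - of_real s * w * eval_fps u w) = P w"
        unfolding P_def D_def eval_fps_theta_step[OF M_entire] uM[OF w] by (simp add: algebra_simps)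
      finally show ?thesis by (simp only: w_def)
    qed
    show "P 0 = 1" by (simp add: P_def eval_fps_at_0 De W_def)
    show "f 0 = 0" by (simp add: f_def)
  qed (rule that pos2 \<beta> \<rho>(1) A unb ev; assumption)+
  have root: "f_root N \<nu> \<beta> x \<longleftrightarrow> 1 - real 2 * real_eval A (x ^ 2 / 4) = \<beta>"
    if x: "0 < x" "x ^ 2 < 4 * \<rho>" for x
  proof -
    define w where "w = x\<^sup>2 / 4"
    have w: "0 \<le> w" "w < \<rho>" and nw: "norm (complex_of_real w) < \<rho>" using x by (simp_all add: w_def norm_power)
    define y uw where "y = w * real_eval (neg_log_deriv D) w" and "uw = real_eval u w"
    have Aw: "real_eval A w = y + \<kappa> * (w * uw)"
      unfolding real_A[OF w] y_def uw_def real_v[OF w] \<kappa>_def by (simp add: algebra_simps)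
    have uw: "eval_fps u (of_real w) = of_real uw"
      unfolding uw_def using eval_fps_of_real[OF u(1) w(1)] in_rad[OF nw u(2)] w by simp
    have Y: "real_eval (fps_X * neg_log_deriv D) w = y"
      unfolding real_eval_def y_def by (subst eval_fps_mult) (use nw w D' in auto)
    define z where "z = complex_of_real x"
    have z: "z \<noteq> 0" "z\<^sup>2 / 4 = of_real w" using x by (simp_all add: z_def w_def)
    have dN: "z * deriv N z \<noteq> 0"
      and ddN: "(z\<^sup>2 * deriv (deriv N) z + of_real (1 - \<nu>) * (z * deriv N z)) / (z * deriv N z) = - of_real (2 * y)"
      using quotient_at_real[OF x(1) s(1) D_def] x(2)
      unfolding s(2-4) z_def[symmetric] w_def[symmetric] Y \<rho>_def by simp_all
    have "N z \<noteq> 0"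
      using N_real(1)[OF x(1)] nonzero_below_first_zero[OF M, of "of_real w"] w \<rho> k z
      by (simp add: frobenius_def z_def[symmetric])
    have zN: "z * deriv N z = of_real (\<nu> - 2 * (w * uw)) * N z"
    proof -
      have e1: "eval_fps D (of_real w) = of_real (1 - s * w * uw) * eval_fps M (of_real w)"
        unfolding D_def eval_fps_theta_step[OF M_entire] uM[OF nw] uw by (simp add: algebra_simps)
      have "\<nu> * (1 - s * w * uw) = \<nu> - 2 * (w * uw)"
        using \<nu> by (simp add: s_def algebra_simps)
      then have e2: "complex_of_real \<nu> * of_real (1 - s * w * uw) = of_real (\<nu> - 2 * (w * uw))"
        by (simp only: flip: of_real_mult)
      have "z * deriv N z = inverse k * of_real \<nu> * frobenius \<nu> D z"
        using linear_combination_at_real(1)[OF x(1) _ D_def] s(1) unfolding s(2) z_def by simp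
      also have "\<dots> = (of_real \<nu> * of_real (1 - s * w * uw)) * (inverse k * frobenius \<nu> M z)"
        unfolding frobenius_def z(2) e1 by (simp only: mult_ac)
      finally show ?thesis unfolding e2 using N_real(1)[OF x(1)] by (simp only: z_def)
    qed
    have q1: "z * deriv N z / N z = of_real (\<nu> - 2 * (w * uw))"
      unfolding zN by (rule nonzero_mult_div_cancel_right[OF \<open>N z \<noteq> 0\<close>])
    have q2: "z * deriv (deriv N) z / deriv N z = - of_real (2 * y) - of_real (1 - \<nu>)"
    proof -
      have "z * deriv (deriv N) z / deriv N z = z\<^sup>2 * deriv (deriv N) z / (z * deriv N z)"
        using z(1) dN by (simp add: power2_eq_square)
      moreover have "z\<^sup>2 * deriv (deriv N) z / (z * deriv N z) + of_real (1 - \<nu>) = - of_real (2 * y)"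
        using ddN unfolding add_divide_distrib nonzero_mult_div_cancel_right[OF dN] .
      ultimately show ?thesis by (simp only: eq_diff_eq)
    qed
    have "1 + z * deriv (deriv N) z / deriv N z + (1 / of_real \<nu> - 1) * (z * deriv N z / N z)
        = of_real (1 - 2 * y - (1 - \<nu>) + \<kappa> * (\<nu> - 2 * (w * uw)))"
      unfolding q1 q2 \<kappa>_def by simp
    also have "1 - 2 * y - (1 - \<nu>) + \<kappa> * (\<nu> - 2 * (w * uw)) = 1 - real 2 * real_eval A w"
      unfolding Aw using \<nu> by (simp add: \<kappa>_def field_simps)
    finally have e: "1 + z * deriv (deriv N) z / deriv N z + (1 / of_real \<nu> - 1) * (z * deriv N z / N z)
        = of_real (1 - real 2 * real_eval A w)" .
    show ?thesis
      unfolding f_root_def Let_def z_def[symmetric] e of_real_eq_iff w_def[symmetric]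
      using dN \<open>N z \<noteq> 0\<close> by simp
  qed
  have least_r: "is_least_pos (f_root N \<nu> \<beta>) r"
    by (rule is_least_posI[where e = 2 and \<beta> = \<beta> and q = "\<lambda>s. 1 - real 2 * real_eval A (s ^ 2 / 4)",
          OF r(1,2) pos2 root r(4,5)])
  have zero_N: "is_least_pos (\<lambda>x. N (of_real x) = 0) (2 * sqrt (first_zero M))"
  proof (rule least_zero_at_first_zero[OF M])
    show "N (of_real x) = 0 \<longleftrightarrow> eval_fps M (of_real (x\<^sup>2 / 4)) = 0" if "0 < x" for x
      using N_real(1)[OF that] k that by (simp add: frobenius_def)
  qed
  have zero_N': "is_least_pos (\<lambda>x. deriv N (of_real x) = 0) (2 * sqrt (first_zero D))"
  proof (rule least_zero_at_first_zero[OF DR])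
    fix x :: real assume x: "0 < x"
    have "of_real x * deriv N (of_real x) = (inverse k * of_real \<nu> * of_real x powr of_real \<nu>) * eval_fps D (of_real (x\<^sup>2 / 4))"
      using linear_combination_at_real(1)[OF x _ D_def] s(1) unfolding s(2) by (simp add: frobenius_def)
    moreover have "inverse k * of_real \<nu> * of_real x powr of_real \<nu> \<noteq> 0" "complex_of_real x \<noteq> 0"
      using \<nu> k x by simp_all
    ultimately show "deriv N (of_real x) = 0 \<longleftrightarrow> eval_fps D (of_real (x\<^sup>2 / 4)) = 0"
      by (metis mult_eq_0_iff)
  qed
  have "sqrt (r\<^sup>2) < sqrt (4 * \<rho>)" using r(2) by (simp only: real_sqrt_less_iff)
  then have "r < 2 * sqrt (first_zero D)" using r(1) by (simp add: real_sqrt_mult \<rho>_def)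
  moreover have "2 * sqrt (first_zero D) < 2 * sqrt (first_zero M)" using lt by simp
  ultimately show thesis by (rule that[OF least_r r(3) zero_N zero_N'])
qed

end

theorem theorem2p2:
  fixes a b c \<nu> \<beta> :: real
  assumes "0 \<le> \<beta>" and "\<beta> < 1"
    and "(c = 0 \<and> a \<noteq> b) \<or> (c > 0 \<and> a < b)"
    and "Q_poly a b c \<nu> \<noteq> 0"
  shows
    "(\<nu> \<ge> max_0_nu0 a b c \<and> \<nu> \<noteq> 0 \<longrightarrow>
       (\<exists>r l' l.
          is_least_pos (f_root (bessel_N a b c \<nu>) \<nu> \<beta>) r \<and>
          convexity_radius \<beta> (f_fun a b c \<nu>) = ereal r \<and>
          is_least_pos (\<lambda>x. bessel_N a b c \<nu> (of_real x) = 0) l \<and>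
          is_least_pos (\<lambda>x. deriv (bessel_N a b c \<nu>) (of_real x) = 0) l' \<and>
          r < l' \<and> l' < l)) \<and>
     (\<nu> \<ge> max_0_nu0 a b c \<longrightarrow>
       (\<exists>r.
          is_least_pos (g_root (bessel_N a b c \<nu>) \<nu> \<beta>) r \<and>
          convexity_radius \<beta> (g_fun a b c \<nu>) = ereal r)) \<and>
     (\<nu> \<ge> max_0_nu0 a b c \<longrightarrow>
       (\<exists>r.
          is_least_pos (h_root (bessel_N a b c \<nu>) \<nu> \<beta>) r \<and>
          convexity_radius \<beta> (h_fun a b c \<nu>) = ereal r))"
proof -
  have Q: "Q_poly a b c \<nu> \<noteq> 0" and \<beta>: "\<beta> < 1" using assms by simp_all
  show ?thesis
  proof (cases "max_0_nu0 a b c \<le> \<nu>")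
    case True
    have \<nu>: "0 \<le> \<nu>" using True by (auto simp: max_0_nu0_def split: if_splits)
    have k: "norm_const a b c \<nu> \<noteq> 0"
    proof -
      have "0 < Gamma (\<nu> + 1)" using \<nu> by (intro Gamma_real_pos) simp
      then show ?thesis using Q by (simp add: norm_const_def)
    qed
    obtain M where M: "rayleigh_positive M"
      and N: "\<And>z. 0 < Re z \<Longrightarrow> bessel_N a b c \<nu> z = inverse (norm_const a b c \<nu>) * frobenius \<nu> M z"
      using normalized_series_exists[OF assms(3) Q True] by blast
    have "\<exists>r l' l. is_least_pos (f_root (bessel_N a b c \<nu>) \<nu> \<beta>) r \<and>
        convexity_radius \<beta> (f_fun a b c \<nu>) = ereal r \<and>
        is_least_pos (\<lambda>x. bessel_N a b c \<nu> (of_real x) = 0) l \<and>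
        is_least_pos (\<lambda>x. deriv (bessel_N a b c \<nu>) (of_real x) = 0) l' \<and> r < l' \<and> l' < l" if "\<nu> \<noteq> 0"
    proof -
      have "0 < \<nu>" using \<nu> that by simp
      show ?thesis
        unfolding f_fun_def
      proof (rule convexity_radius_f[OF M k _ \<beta> \<open>0 < \<nu>\<close>])
        show "bessel_N a b c \<nu> z = inverse (norm_const a b c \<nu>) * frobenius \<nu> M z" if "0 < Re z" for z
          by (rule N[OF that])
      qed blast
    qed
    moreover have "\<exists>r. is_least_pos (g_root (bessel_N a b c \<nu>) \<nu> \<beta>) r \<and>
        convexity_radius \<beta> (g_fun a b c \<nu>) = ereal r"
      unfolding g_fun_def by (rule convexity_radius_g[OF M k N \<beta>])
    moreover have "\<exists>r. is_least_pos (h_root (bessel_N a b c \<nu>) \<nu> \<beta>) r \<and>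
        convexity_radius \<beta> (h_fun a b c \<nu>) = ereal r"
      unfolding h_fun_def by (rule convexity_radius_h[OF M k N \<beta>])
    ultimately show ?thesis by blast
  qed simp
qed

end
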